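(* Let $X$ be a type $\mathscr{L}$ random variable with characteristic function of the form $\phi_X(t) = e^{-a t^2/2}\prod_{j=1}^\infty(1-b_jt^2)$, $t\in\mathbb{R}$, with $a > 0$, $b_j \geq 0$ for all $j$, and $\sum_{j} b_j \leq a$. Let $\sigma = \sqrt{\operatorname{Var}(X)}$. Then for every real $p \geq 3$, $$\mathbb{E}\left|\frac{\sigma Z_1}{\sqrt{3}}\right|^p \leq \mathbb{E}|X|^p \leq \mathbb{E}|\sigma Z_0|^p,$$ where $Z_0$ is a standard Gaussian random variable and $Z_1$ is a random variable with density $(2\pi)^{-1/2}x^2e^{-x^2/2}$ on $\mathbb{R}$ (so that $\operatorname{Var}(Z_1)=3$).
   Context: A real-valued random variable $X$ is of type $\mathscr{L}$ if (i) there are positive constants $C, C'$ such that $|\mathbb{E}\exp(zX)| \leq C\exp(C'|z|^2)$ for all $z \in \mathbb{C}$, and (ii) the function $z \mapsto \mathbb{E}\exp(zX)$ on $\mathbb{C}$ is even and has only pure imaginary zeros (it may have no zeros at all). The characteristic function of $X$ is $\phi_X(t) = \mathbb{E}e^{itX}$. *)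

theory Defs
  imports "HOL-Probability.Probability"
begin

definition complex_mgf :: "'a measure \<Rightarrow> ('a \<Rightarrow> real) \<Rightarrow> complex \<Rightarrow> complex" where
  "complex_mgf M X z = (CLINT w|M. exp (z * complex_of_real (X w)))"

(* The Bochner integral of a non-integrable function is 0, so the existence of the
   expectation, implicit in the growth bound, has to be stated separately. *)
definition type_L :: "'a measure \<Rightarrow> ('a \<Rightarrow> real) \<Rightarrow> bool" where
  "type_L M X \<longleftrightarrow>
     (\<forall>z. complex_integrable M (\<lambda>w. exp (z * complex_of_real (X w)))) \<and>
     (\<exists>C>0. \<exists>C'>0. \<forall>z. cmod (complex_mgf M X z) \<le> C * exp (C' * (cmod z)\<^sup>2)) \<and>
     (\<forall>z. complex_mgf M X (- z) = complex_mgf M X z) \<and>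
     (\<forall>z. complex_mgf M X z = 0 \<longrightarrow> Re z = 0)"

definition Z1_density :: "real \<Rightarrow> real" where
  "Z1_density x = 1 / sqrt (2 * pi) * x\<^sup>2 * exp (- (x\<^sup>2) / 2)"

end

theory Submission
  imports Defs "HOL-Real_Asymp.Real_Asymp"
begin

text \<open>
  The characteristic function says that \<open>X\<close> is distributed like a sum of independent variables
  \<open>sqrt (b j) * Z1\<close> and a Gaussian of variance \<open>a - (\<Sum>j. b j)\<close>. Let \<open>m\<close> be its variance. Both bounds
  compare \<open>X\<close> with a variable of the same variance, and both are instances of one principle: if
  \<open>\<phi>\<close> and \<open>\<psi>\<close> are the characteristic functions of symmetric variables \<open>X\<close> and \<open>Y\<close> with equal
  variance, and \<open>(\<psi> t - \<phi> t) / t ^ 4\<close> has a nonnegative Fourier transform, then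
  \<open>E f(X) \<le> E f(Y)\<close> for functions \<open>f\<close> of moderate growth with nonnegative fourth derivative. The
  power \<open>\<bar>x\<bar> powr p\<close> with \<open>p \<ge> 3\<close> is such a function, in the sense of distributions; for \<open>p = 3\<close> its
  fourth derivative is a point mass at the origin, and for \<open>2 < p < 3\<close> it is negative elsewhere.

  To avoid distributions, the power is written as a positive mixture of the truncated cubes
  \<open>(max 0 (\<bar>x\<bar> - u)) ^ 3\<close>, a Beta integral (\<open>powr_eq_trunc_cube_mixture\<close>). A truncated cube is, up to
  multiples of \<open>x\<^sup>2\<close> and constants, the average of \<open>\<bar>x - u\<bar> ^ 3\<close> and \<open>\<bar>x + u\<bar> ^ 3\<close>; and \<open>\<bar>x\<bar> ^ 3\<close> is a
  constant times the integral of \<open>(cos (x * t) - 1 + (x * t)\<^sup>2 / 2) / t ^ 4\<close> over \<open>t\<close>. Taking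
  expectations, the difference of the two truncated third moments at level \<open>u\<close> becomes a positive
  multiple of the integral of \<open>(\<psi> t - \<phi> t) / t ^ 4 * cos (t * u)\<close> (\<open>trunc_cube_mono\<close>).

  It remains to find positivity in the characteristic functions. The class of functions with
  nonnegative (Gaussian damped) cosine transforms contains the constants \<open>\<ge> 0\<close> and is stable under
  multiplication by \<open>exp (- s * t\<^sup>2)\<close> and by \<open>(1 - b * t\<^sup>2) * exp (- b * t\<^sup>2 / 2)\<close>, the characteristic
  function of \<open>sqrt b * Z1\<close>, and under mixtures and bounded limits. With \<open>v = t\<^sup>2\<close>:

  \<^item> Upper bound. Replacing a factor \<open>1 - b * v\<close> by \<open>exp (- b * v)\<close> changes the characteristic
    function by a multiple of \<open>exp (- b * v) - 1 + b * v\<close>, which is \<open>v\<^sup>2\<close> times a mixture of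
    Gaussians. Once all factors are replaced, what is left is the Gaussian of variance \<open>m\<close>.

  \<^item> Lower bound. Merging the factors \<open>1 - b * v\<close> and \<open>1 - c * v\<close> into \<open>1 - (b + c) * v\<close> removes
    \<open>b * c * v\<^sup>2\<close>. When one factor \<open>1 - B * v\<close> is left, increasing \<open>B\<close> at fixed variance again changes
    the function by \<open>v\<^sup>2\<close> times Gaussians, and ends at the law of \<open>sqrt (m / 3) * Z1\<close>.

  The condition \<open>(\<Sum>j. b j) \<le> a\<close> provides each quadratic factor with the Gaussian that turns it into
  a characteristic function, and gives \<open>(\<Sum>j. b j) \<le> m / 3\<close> for the last step.
\<close>

section \<open>Cosine transforms of the two extremal densities\<close>

lemma integrable_gauss:
  fixes c :: real assumes "c > 0" shows "integrable lborel (\<lambda>t::real. exp (- c * t\<^sup>2))"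
proof -
  have s: "sqrt (1 / (2*c)) > 0" "(sqrt (1/(2*c)))\<^sup>2 = 1/(2*c)" using assms by auto
  have "integrable lborel (\<lambda>t. sqrt (2 * pi * (1 / (2*c))) * normal_density 0 (sqrt (1/(2*c))) t)"
    by (intro integrable_mult_right integrable_normal_density) (use s in auto)
  also have "(\<lambda>t. sqrt (2 * pi * (1 / (2*c))) * normal_density 0 (sqrt (1/(2*c))) t) = (\<lambda>t. exp (- c * t\<^sup>2))"
    using assms s unfolding normal_density_def by (auto simp: fun_eq_iff field_simps)
  finally show ?thesis .
qed

lemma std_normal_cos_transform:
  "(\<integral>x. std_normal_density x * cos (t * x) \<partial>lborel) = exp (- (t\<^sup>2) / 2)"
proof -
  interpret real_distribution std_normal_distribution by (rule real_dist_normal_dist)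
  have "exp (- (t\<^sup>2) / 2) = Re (char std_normal_distribution t)"
    by (simp add: char_std_normal_distribution)
  also have "\<dots> = (\<integral>x. cos (t * x) \<partial>std_normal_distribution)"
    unfolding char_def by (subst integral_Re[symmetric]) (auto intro!: integrable_iexp simp: Re_exp)
  also have "\<dots> = (\<integral>x. std_normal_density x * cos (t * x) \<partial>lborel)"
    by (subst integral_real_density) auto
  finally show ?thesis by simp
qed

text \<open>
  The cosine transform of a Gaussian is again a Gaussian.
\<close>

lemma gauss_cos_transform_nonneg:
  fixes c u :: real
  assumes "c > 0"
  shows "0 \<le> (\<integral>t. exp (- c * t\<^sup>2) * cos (t * u) \<partial>lborel)"
proof -
  define k where "k = 1 / sqrt (2 * c)"
  have k: "k > 0" "c * k\<^sup>2 = 1 / 2" using assms by (auto simp: k_def power_divide)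
  have "(\<integral>t. exp (- c * t\<^sup>2) * cos (t * u) \<partial>lborel)
      = \<bar>k\<bar> *\<^sub>R (\<integral>x. exp (- c * (0 + k * x)\<^sup>2) * cos ((0 + k * x) * u) \<partial>lborel)"
    by (rule lborel_integral_real_affine) (use k in auto)
  also have "(\<lambda>x. exp (- c * (0 + k * x)\<^sup>2) * cos ((0 + k * x) * u))
      = (\<lambda>x. sqrt (2 * pi) * (std_normal_density x * cos ((k * u) * x)))"
  proof
    fix x
    have "c * (0 + k * x)\<^sup>2 = (c * k\<^sup>2) * x\<^sup>2" by (simp add: power_mult_distrib)
    then show "exp (- c * (0 + k * x)\<^sup>2) * cos ((0 + k * x) * u)
      = sqrt (2 * pi) * (std_normal_density x * cos ((k * u) * x))"
      using k by (simp add: std_normal_density_def ac_simps)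
  qed
  also have "(\<integral>x. sqrt (2 * pi) * (std_normal_density x * cos ((k * u) * x)) \<partial>lborel)
      = sqrt (2 * pi) * exp (- ((k*u)\<^sup>2) / 2)"
    by (simp add: std_normal_cos_transform)
  finally show ?thesis using k by simp
qed

lemma Z1_density_eq: "Z1_density x = std_normal_density x * x\<^sup>2"
  by (simp add: Z1_density_def std_normal_density_def)

lemma Z1_density_nonneg: "0 \<le> Z1_density x"
  by (simp add: Z1_density_def)

lemma borel_measurable_Z1_density[measurable]: "Z1_density \<in> borel_measurable borel"
  unfolding Z1_density_def[abs_def] by measurable

lemma integrable_Z1_density: "integrable lborel Z1_density"
  unfolding Z1_density_eq[abs_def] by (rule integrable_std_normal_moment)

lemma tendsto_linear_std_normal_density:
  "((\<lambda>x. (1 + \<bar>x\<bar>) * std_normal_density x) \<longlongrightarrow> 0) at_top"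
  "((\<lambda>x. (1 + \<bar>x\<bar>) * std_normal_density x) \<longlongrightarrow> 0) at_bot"
  unfolding std_normal_density_def by real_asymp+

text \<open>
  The fundamental theorem of calculus on the whole line, for primitives that decay because they
  are a Gaussian times a factor of linear growth. This is the only form of integration by parts
  that the transform of \<open>Z1_density\<close> requires.
\<close>

lemma std_normal_integral_derivative_zero:
  fixes F f g :: "real \<Rightarrow> real"
  assumes F: "\<And>x. F x = std_normal_density x * g x"
    and g: "\<And>x. \<bar>g x\<bar> \<le> 1 + \<bar>x\<bar>"
    and der: "\<And>x. (F has_real_derivative f x) (at x)"
    and cont: "\<And>x. isCont f x"
    and int: "integrable lborel f"
  shows "(\<integral>x. f x \<partial>lborel) = 0"
proof -
  have F_le: "norm (F x) \<le> (1 + \<bar>x\<bar>) * std_normal_density x" for x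
    using mult_left_mono[OF g, of "std_normal_density x" x]
    by (simp add: F abs_mult algebra_simps)
  have "(LBINT x=-\<infinity>..\<infinity>. f x) = 0 - 0"
  proof (rule interval_integral_FTC_integrable[where F = F])
    show "(F has_vector_derivative f x) (at x)" for x
      using der by (simp add: has_real_derivative_iff_has_vector_derivative)
    show "set_integrable lborel (einterval (-\<infinity>) \<infinity>) f"
      using int by (simp add: set_integrable_def)
    have "(F \<longlongrightarrow> 0) at_bot"
      by (rule Lim_null_comparison[OF always_eventually tendsto_linear_std_normal_density(2)]) (use F_le in auto)
    then show "((F \<circ> real_of_ereal) \<longlongrightarrow> 0) (at_right (-\<infinity>))"
      by (simp add: ereal_tendsto_simps)
    have "(F \<longlongrightarrow> 0) at_top"
      by (rule Lim_null_comparison[OF always_eventually tendsto_linear_std_normal_density(1)]) (use F_le in auto)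
    then show "((F \<circ> real_of_ereal) \<longlongrightarrow> 0) (at_left \<infinity>)"
      by (simp add: ereal_tendsto_simps)
  qed (use cont in auto)
  then show ?thesis
    by (simp add: interval_lebesgue_integral_def set_lebesgue_integral_def)
qed

lemma DERIV_std_normal_density:
  "(std_normal_density has_real_derivative (- x * std_normal_density x)) (at x)"
  unfolding std_normal_density_def[abs_def]
  by (auto intro!: derivative_eq_intros simp: field_simps)

text \<open>
  Integrating the derivatives of \<open>std_normal_density x * sin (t * x)\<close> and
  \<open>std_normal_density x * (x * cos (t * x))\<close> to zero expresses the transform of
  \<open>x\<^sup>2 * std_normal_density x\<close> through that of \<open>x * std_normal_density x\<close>, and the latter through
  the transform of the Gaussian itself.
\<close>

lemma Z1_cos_transform:
  "(\<integral>x. Z1_density x * cos (t * x) \<partial>lborel) = (1 - t\<^sup>2) * exp (- (t\<^sup>2) / 2)"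
proof -
  let ?d = std_normal_density
  have i: "integrable lborel (\<lambda>x. ?d x * x ^ k * h x)"
    if "h \<in> borel_measurable borel" "\<And>x. \<bar>h x\<bar> \<le> 1" for k and h :: "real \<Rightarrow> real"
    by (rule Bochner_Integration.integrable_bound[OF integrable_std_normal_moment_abs[of k]])
       (use that mult_left_mono[OF that(2)] in \<open>auto simp: abs_mult power_abs\<close>)
  have i0: "integrable lborel (\<lambda>x. ?d x * cos (t * x))" using i[of "\<lambda>x. cos (t*x)" 0] by simp
  have i1: "integrable lborel (\<lambda>x. ?d x * x * sin (t * x))" using i[of "\<lambda>x. sin (t*x)" 1] by simp
  have i2: "integrable lborel (\<lambda>x. ?d x * x\<^sup>2 * cos (t * x))" using i[of "\<lambda>x. cos (t*x)" 2] by simp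
  have c: "isCont ?d x" for x by (rule DERIV_isCont[OF DERIV_std_normal_density])
  have 1: "(\<integral>x. t * (?d x * cos (t * x)) - ?d x * x * sin (t * x) \<partial>lborel) = 0"
  proof (rule std_normal_integral_derivative_zero)
    show "((\<lambda>x. ?d x * sin (t * x)) has_real_derivative t * (?d x * cos (t * x)) - ?d x * x * sin (t * x)) (at x)" for x
      by (auto intro!: derivative_eq_intros DERIV_std_normal_density simp: algebra_simps)
    show "\<bar>sin (t * x)\<bar> \<le> 1 + \<bar>x\<bar>" for x using abs_sin_le_one[of "t*x"] by linarith
  qed (use i0 i1 c in \<open>auto intro!: continuous_intros\<close>)
  have 2: "(\<integral>x. ?d x * cos (t * x) - ?d x * x\<^sup>2 * cos (t * x) - t * (?d x * x * sin (t * x)) \<partial>lborel) = 0"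
  proof (rule std_normal_integral_derivative_zero)
    show "((\<lambda>x. ?d x * (x * cos (t * x))) has_real_derivative ?d x * cos (t * x) - ?d x * x\<^sup>2 * cos (t * x) - t * (?d x * x * sin (t * x))) (at x)" for x
      by (auto intro!: derivative_eq_intros DERIV_std_normal_density simp: algebra_simps power2_eq_square)
    show "\<bar>x * cos (t * x)\<bar> \<le> 1 + \<bar>x\<bar>" for x
      using abs_cos_le_one[of "t*x"] mult_left_mono[of "\<bar>cos (t*x)\<bar>" 1 "\<bar>x\<bar>"] by (simp add: abs_mult)
  qed (use i0 i1 i2 c in \<open>auto intro!: continuous_intros\<close>)
  have first: "t * (\<integral>x. ?d x * cos (t * x) \<partial>lborel) = (\<integral>x. ?d x * x * sin (t * x) \<partial>lborel)"
    using 1 i0 i1 by (subst (asm) Bochner_Integration.integral_diff) auto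
  have second: "(\<integral>x. ?d x * x\<^sup>2 * cos (t * x) \<partial>lborel)
      = (\<integral>x. ?d x * cos (t * x) \<partial>lborel) - t * (\<integral>x. ?d x * x * sin (t * x) \<partial>lborel)"
    using 2 i0 i1 i2 by simp
  have "(\<integral>x. ?d x * x\<^sup>2 * cos (t * x) \<partial>lborel)
      = (\<integral>x. ?d x * cos (t * x) \<partial>lborel) - t * (t * (\<integral>x. ?d x * cos (t * x) \<partial>lborel))"
    unfolding first by (rule second)
  then show ?thesis by (simp add: Z1_density_eq std_normal_cos_transform left_diff_distrib power2_eq_square)
qed

section \<open>Functions of positive type\<close>

text \<open>
  A bounded continuous even function of this kind is the Fourier transform of a positive measure.
  Stating positivity for the integrals damped by a Gaussian makes them converge for
  every bounded function, so that the class is visibly closed under all the operations needed below: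
  sums, mixtures, bounded limits, and products with cosines and hence with the transforms of
  symmetric densities. No measure has to be constructed. The bound \<open>C\<close> is recorded because limits
  are taken by dominated convergence.
\<close>

definition pos_type :: "real \<Rightarrow> (real \<Rightarrow> real) \<Rightarrow> bool" where
  "pos_type C F \<longleftrightarrow> F \<in> borel_measurable borel \<and> (\<forall>t. \<bar>F t\<bar> \<le> C) \<and>
     (\<forall>c>0. \<forall>u. 0 \<le> (\<integral>t. F t * exp (- c * t\<^sup>2) * cos (t * u) \<partial>lborel))"

lemma pos_typeI:
  assumes "F \<in> borel_measurable borel" "\<And>t. \<bar>F t\<bar> \<le> C"
    "\<And>c u. c > 0 \<Longrightarrow> 0 \<le> (\<integral>t. F t * exp (- c * t\<^sup>2) * cos (t * u) \<partial>lborel)"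
  shows "pos_type C F"
  using assms by (auto simp: pos_type_def)

lemma pos_type_measurable: "pos_type C F \<Longrightarrow> F \<in> borel_measurable borel"
  by (simp add: pos_type_def)

lemma pos_type_abs_le: "pos_type C F \<Longrightarrow> \<bar>F t\<bar> \<le> C"
  by (simp add: pos_type_def)

lemma pos_type_bound_nonneg: "pos_type C F \<Longrightarrow> 0 \<le> C"
  using abs_ge_zero order_trans pos_type_abs_le by blast

lemma pos_type_transform_nonneg:
  "pos_type C F \<Longrightarrow> c > 0 \<Longrightarrow> 0 \<le> (\<integral>t. F t * exp (- c * t\<^sup>2) * cos (t * u) \<partial>lborel)"
  by (simp add: pos_type_def)

lemma pos_type_mono: "pos_type C F \<Longrightarrow> C \<le> D \<Longrightarrow> pos_type D F"
  by (auto simp: pos_type_def intro: order_trans)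

lemma pos_type_damped_bound:
  assumes "pos_type C F"
  shows "\<bar>F t * exp (- c * t\<^sup>2) * cos (t * u)\<bar> \<le> C * exp (- c * t\<^sup>2)"
proof -
  have "\<bar>F t\<bar> * exp (- c * t\<^sup>2) * \<bar>cos (t * u)\<bar> \<le> C * exp (- c * t\<^sup>2) * 1"
    using pos_type_abs_le[OF assms] pos_type_bound_nonneg[OF assms]
    by (intro mult_mono) auto
  then show ?thesis by (simp add: abs_mult)
qed

lemma pos_type_integrable:
  assumes "pos_type C F" "c > 0"
  shows "integrable lborel (\<lambda>t. F t * exp (- c * t\<^sup>2) * cos (t * u))"
proof (rule Bochner_Integration.integrable_bound)
  show "integrable lborel (\<lambda>t. C * exp (- c * t\<^sup>2))"
    using integrable_gauss[OF assms(2)] by simp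
  show "(\<lambda>t. F t * exp (- c * t\<^sup>2) * cos (t * u)) \<in> borel_measurable lborel"
    using pos_type_measurable[OF assms(1)] by simp
qed (use pos_type_damped_bound[OF assms(1)] in \<open>auto intro!: AE_I2 order_trans[OF _ abs_ge_self]\<close>)

lemma pos_type_const: "0 \<le> r \<Longrightarrow> pos_type r (\<lambda>_. r)"
  using gauss_cos_transform_nonneg
  by (intro pos_typeI) (auto simp: mult.assoc)

lemma pos_type_add:
  assumes "pos_type C F" "pos_type D G"
  shows "pos_type (C + D) (\<lambda>t. F t + G t)"
proof (rule pos_typeI)
  show "(\<lambda>t. F t + G t) \<in> borel_measurable borel"
    using assms[THEN pos_type_measurable] by simp
  show "\<bar>F t + G t\<bar> \<le> C + D" for t
    using assms[THEN pos_type_abs_le, of t] by linarith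
  show "0 \<le> (\<integral>t. (F t + G t) * exp (- c * t\<^sup>2) * cos (t * u) \<partial>lborel)" if "c > 0" for c u
    using pos_type_integrable[OF assms(1) that, of u] pos_type_integrable[OF assms(2) that, of u]
      pos_type_transform_nonneg[OF assms(1) that, of u] pos_type_transform_nonneg[OF assms(2) that, of u]
    by (simp add: distrib_right)
qed

lemma pos_type_mult_gauss:
  assumes "pos_type C F" "s \<ge> 0"
  shows "pos_type C (\<lambda>t. F t * exp (- s * t\<^sup>2))"
proof (rule pos_typeI)
  show "(\<lambda>t. F t * exp (- s * t\<^sup>2)) \<in> borel_measurable borel"
    using pos_type_measurable[OF assms(1)] by simp
  show "\<bar>F t * exp (- s * t\<^sup>2)\<bar> \<le> C" for t
    using mult_mono[OF pos_type_abs_le[OF assms(1)], of "exp (- s * t\<^sup>2)" 1 t] assms(2)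
      pos_type_bound_nonneg[OF assms(1)] by (simp add: abs_mult)
  show "0 \<le> (\<integral>t. F t * exp (- s * t\<^sup>2) * exp (- c * t\<^sup>2) * cos (t * u) \<partial>lborel)" if "c > 0" for c u
    using pos_type_transform_nonneg[OF assms(1), of "s + c" u] that assms(2)
    by (simp add: algebra_simps exp_diff exp_add exp_minus divide_inverse)
qed

text \<open>
  By the product formula for cosines, multiplication by \<open>cos (x * t)\<close> replaces the transform at
  \<open>u\<close> by the average of its values at \<open>u - x\<close> and \<open>u + x\<close>.
\<close>

lemma pos_type_mult_cos:
  assumes "pos_type C F"
  shows "pos_type C (\<lambda>t. F t * cos (x * t))"
proof (rule pos_typeI)
  show "(\<lambda>t. F t * cos (x * t)) \<in> borel_measurable borel"
    using pos_type_measurable[OF assms(1)] by simp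
  show "\<bar>F t * cos (x * t)\<bar> \<le> C" for t
    using mult_mono[OF pos_type_abs_le[OF assms(1)], of "\<bar>cos (x * t)\<bar>" 1 t]
      pos_type_bound_nonneg[OF assms(1)] by (simp add: abs_mult)
  show "0 \<le> (\<integral>t. F t * cos (x * t) * exp (- c * t\<^sup>2) * cos (t * u) \<partial>lborel)" if "c > 0" for c u
  proof -
    let ?f = "\<lambda>u t. F t * exp (- c * t\<^sup>2) * cos (t * u)"
    have eq: "F t * cos (x * t) * exp (- c * t\<^sup>2) * cos (t * u) = (?f (u - x) t + ?f (u + x) t) / 2" for t
    proof -
      have "cos (x * t) * cos (t * u) = (cos (t * (u - x)) + cos (t * (u + x))) / 2"
        by (simp add: distrib_left right_diff_distrib cos_add cos_diff mult.commute)
      then have "F t * exp (- c * t\<^sup>2) * (cos (x * t) * cos (t * u))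
         = F t * exp (- c * t\<^sup>2) * ((cos (t * (u - x)) + cos (t * (u + x))) / 2)" by simp
      then show ?thesis by (simp add: algebra_simps)
    qed
    show ?thesis unfolding eq
      using pos_type_integrable[OF assms that, of "u - x"] pos_type_integrable[OF assms that, of "u + x"]
        pos_type_transform_nonneg[OF assms that, of "u - x"] pos_type_transform_nonneg[OF assms that, of "u + x"]
      by simp
  qed
qed

text \<open>
  Fubini's theorem moves the mixing integral outside; the Gaussian damping supplies absolute
  convergence. Positivity of \<open>K x\<close> is only asked where \<open>w\<close> charges \<open>x\<close>, so that indicator
  functions in \<open>w\<close> can restrict the parameter range.
\<close>

lemma pos_type_mixture:
  fixes w :: "real \<Rightarrow> real" and K :: "real \<Rightarrow> real \<Rightarrow> real"
  assumes w: "integrable lborel w" "\<And>x. 0 \<le> w x"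
    and K: "(\<lambda>(x, t). K x t) \<in> borel_measurable (borel \<Otimes>\<^sub>M borel)"
    and pos: "\<And>x. w x \<noteq> 0 \<Longrightarrow> pos_type C (K x)"
    and C: "0 \<le> C"
  shows "pos_type (C * (\<integral>x. w x \<partial>lborel)) (\<lambda>t. \<integral>x. w x * K x t \<partial>lborel)"
proof (rule pos_typeI)
  have [measurable]: "w \<in> borel_measurable borel" using w(1) by simp
  have [measurable]: "(\<lambda>p. K (fst p) (snd p)) \<in> borel_measurable (borel \<Otimes>\<^sub>M borel)"
    using K by (simp add: case_prod_beta')
  have [measurable]: "(\<lambda>p. K (snd p) (fst p)) \<in> borel_measurable (borel \<Otimes>\<^sub>M borel)"
    using measurable_compose[OF measurable_Pair[OF measurable_snd measurable_fst] K] by simp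
  have le: "\<bar>w x * K x t\<bar> \<le> C * w x" for x t
    using pos_type_abs_le[OF pos, of x t] w(2)[of x] by (cases "w x = 0") (auto simp: abs_mult mult.commute)
  show "(\<lambda>t. \<integral>x. w x * K x t \<partial>lborel) \<in> borel_measurable borel"
    by measurable
  have Kx: "(\<lambda>x. K x t) \<in> borel_measurable borel" for t
    using measurable_compose[OF measurable_Pair[OF measurable_ident measurable_const] K] by simp
  have iw: "integrable lborel (\<lambda>x. w x * K x t)" for t
    by (rule Bochner_Integration.integrable_bound[of _ "\<lambda>x. C * w x"])
       (use w le Kx in \<open>auto intro!: AE_I2 order_trans[OF _ abs_ge_self]\<close>)
  show "\<bar>\<integral>x. w x * K x t \<partial>lborel\<bar> \<le> C * (\<integral>x. w x \<partial>lborel)" for t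
  proof -
    have "\<bar>\<integral>x. w x * K x t \<partial>lborel\<bar> \<le> (\<integral>x. \<bar>w x * K x t\<bar> \<partial>lborel)"
      by (rule integral_abs_bound)
    also have "\<dots> \<le> (\<integral>x. C * w x \<partial>lborel)"
      using iw w le by (intro integral_mono) auto
    finally show ?thesis by simp
  qed
  fix c u :: real assume c: "c > 0"
  let ?g = "\<lambda>t. exp (- c * t\<^sup>2)"
  let ?f = "\<lambda>x t. w x * (K x t * ?g t * cos (t * u))"
  have le': "\<bar>?f x t\<bar> \<le> (C * w x) * ?g t" for x t
  proof -
    have "\<bar>w x * K x t\<bar> * ?g t * \<bar>cos (t * u)\<bar> \<le> (C * w x) * ?g t * 1"
      using le[of x t] C w(2)[of x] by (intro mult_mono) auto
    then show ?thesis by (simp add: abs_mult mult.assoc)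
  qed
  have "integrable (lborel \<Otimes>\<^sub>M lborel) (\<lambda>p. (C * w (fst p)) * ?g (snd p))"
    using w integrable_gauss[OF c] C
    by (intro lborel_pair.Fubini_integrable) (auto simp: abs_mult)
  then have int: "integrable (lborel \<Otimes>\<^sub>M lborel) (\<lambda>(x, t). ?f x t)"
    by (rule Bochner_Integration.integrable_bound) (use le' in \<open>auto simp: case_prod_beta' intro!: AE_I2 order_trans[OF _ abs_ge_self]\<close>)
  have "(\<integral>t. (\<integral>x. w x * K x t \<partial>lborel) * ?g t * cos (t * u) \<partial>lborel)
      = (\<integral>t. (\<integral>x. ?f x t \<partial>lborel) \<partial>lborel)"
    using iw by (intro Bochner_Integration.integral_cong refl)
      (simp add: mult.assoc[symmetric])
  also have "\<dots> = (\<integral>x. (\<integral>t. ?f x t \<partial>lborel) \<partial>lborel)"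
    by (rule lborel_pair.Fubini_integral[OF int])
  also have "(\<integral>x. (\<integral>t. ?f x t \<partial>lborel) \<partial>lborel) \<ge> 0"
  proof (rule integral_nonneg_AE, rule AE_I2)
    show "0 \<le> (\<integral>t. ?f x t \<partial>lborel)" for x
      using w(2)[of x] pos_type_transform_nonneg[OF pos c, of x u] by (cases "w x = 0") simp_all
  qed
  finally show "0 \<le> (\<integral>t. (\<integral>x. w x * K x t \<partial>lborel) * ?g t * cos (t * u) \<partial>lborel)" .
qed

text \<open>
  The factor is the characteristic function of \<open>sqrt b\<close> times a variable with density
  \<open>Z1_density\<close>, that is, a mixture of cosines.
\<close>

lemma pos_type_mult_Z1_transform:
  assumes F: "pos_type C F" and b: "b \<ge> 0"
  shows "pos_type C (\<lambda>t. F t * ((1 - b * t\<^sup>2) * exp (- b * t\<^sup>2 / 2)))"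
proof -
  note [measurable] = pos_type_measurable[OF F]
  have mix: "pos_type (C * (\<integral>x. Z1_density x \<partial>lborel))
      (\<lambda>t. \<integral>x. Z1_density x * (F t * cos ((sqrt b * x) * t)) \<partial>lborel)"
  proof (rule pos_type_mixture)
    show "(\<lambda>(x, t). F t * cos ((sqrt b * x) * t)) \<in> borel_measurable (borel \<Otimes>\<^sub>M borel)"
      by measurable
  qed (rule integrable_Z1_density Z1_density_nonneg pos_type_mult_cos[OF F] pos_type_bound_nonneg[OF F])+
  have mass: "(\<integral>x. Z1_density x \<partial>lborel) = 1"
    using Z1_cos_transform[of 0] by simp
  have transform: "(\<integral>x. Z1_density x * (F t * cos ((sqrt b * x) * t)) \<partial>lborel)
      = F t * ((1 - b * t\<^sup>2) * exp (- b * t\<^sup>2 / 2))" for t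
  proof -
    have "(\<integral>x. Z1_density x * (F t * cos ((sqrt b * x) * t)) \<partial>lborel)
      = (\<integral>x. F t * (Z1_density x * cos ((sqrt b * t) * x)) \<partial>lborel)"
      by (simp add: mult.assoc mult.left_commute mult.commute[of t])
    also have "\<dots> = F t * (\<integral>x. Z1_density x * cos ((sqrt b * t) * x) \<partial>lborel)"
      by simp
    also have "\<dots> = F t * ((1 - b * t\<^sup>2) * exp (- b * t\<^sup>2 / 2))"
      using b by (simp add: Z1_cos_transform power_mult_distrib)
    finally show ?thesis .
  qed
  show ?thesis
    using mix unfolding mass transform mult_1_right .
qed

lemma pos_type_limit:
  assumes F: "\<And>n. pos_type C (F n)" and lim: "\<And>t. (\<lambda>n. F n t) \<longlonglongrightarrow> G t"
  shows "pos_type C G"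
proof (rule pos_typeI)
  note [measurable] = pos_type_measurable[OF F]
  show G[measurable]: "G \<in> borel_measurable borel"
    by (rule borel_measurable_LIMSEQ_real[OF lim]) measurable
  show "\<bar>G t\<bar> \<le> C" for t
    by (rule LIMSEQ_le_const2[OF tendsto_rabs[OF lim]]) (use pos_type_abs_le[OF F] in auto)
  fix c u :: real assume c: "c > 0"
  have "(\<lambda>n. \<integral>t. F n t * exp (- c * t\<^sup>2) * cos (t * u) \<partial>lborel)
      \<longlonglongrightarrow> (\<integral>t. G t * exp (- c * t\<^sup>2) * cos (t * u) \<partial>lborel)"
  proof (rule integral_dominated_convergence)
    show "integrable lborel (\<lambda>t. C * exp (- c * t\<^sup>2))" using integrable_gauss[OF c] by simp
    show "AE t in lborel. norm (F n t * exp (- c * t\<^sup>2) * cos (t * u)) \<le> C * exp (- c * t\<^sup>2)" for n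
      using pos_type_damped_bound[OF F] by simp
    show "AE t in lborel. (\<lambda>n. F n t * exp (- c * t\<^sup>2) * cos (t * u))
       \<longlonglongrightarrow> G t * exp (- c * t\<^sup>2) * cos (t * u)"
      using lim by (auto intro!: tendsto_intros)
  qed auto
  then show "0 \<le> (\<integral>t. G t * exp (- c * t\<^sup>2) * cos (t * u) \<partial>lborel)"
    by (rule LIMSEQ_le_const) (use pos_type_transform_nonneg[OF F c] in auto)
qed

text \<open>
  For an integrable function the damping can be removed by letting \<open>c\<close> tend to zero.
\<close>

lemma pos_type_undamped_transform_nonneg:
  assumes F: "pos_type C F" and int: "integrable lborel F"
  shows "0 \<le> (\<integral>t. F t * cos (t * u) \<partial>lborel)"
proof -
  note [measurable] = pos_type_measurable[OF F]
  have "(\<lambda>n. \<integral>t. F t * exp (- inverse (real (Suc n)) * t\<^sup>2) * cos (t * u) \<partial>lborel)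
      \<longlonglongrightarrow> (\<integral>t. F t * cos (t * u) \<partial>lborel)"
  proof (rule integral_dominated_convergence)
    show "integrable lborel (\<lambda>t. \<bar>F t\<bar>)" using int by simp
    show "AE t in lborel. norm (F t * exp (- inverse (real (Suc n)) * t\<^sup>2) * cos (t * u)) \<le> \<bar>F t\<bar>" for n
    proof (rule AE_I2)
      fix t
      have "\<bar>F t\<bar> * exp (- inverse (real (Suc n)) * t\<^sup>2) * \<bar>cos (t * u)\<bar> \<le> \<bar>F t\<bar> * 1 * 1"
        by (intro mult_mono) auto
      then show "norm (F t * exp (- inverse (real (Suc n)) * t\<^sup>2) * cos (t * u)) \<le> \<bar>F t\<bar>"
        by (simp add: abs_mult)
    qed
    have "(\<lambda>n. F t * exp (- inverse (real (Suc n)) * t\<^sup>2) * cos (t * u))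
       \<longlonglongrightarrow> F t * exp (- 0 * t\<^sup>2) * cos (t * u)" for t
      by (intro tendsto_intros LIMSEQ_inverse_real_of_nat)
    then show "AE t in lborel. (\<lambda>n. F t * exp (- inverse (real (Suc n)) * t\<^sup>2) * cos (t * u))
       \<longlonglongrightarrow> F t * cos (t * u)" by simp
  qed auto
  then show ?thesis
    by (rule LIMSEQ_le_const) (blast intro: pos_type_transform_nonneg[OF F] positive_imp_inverse_positive of_nat_0_less_iff[THEN iffD2] zero_less_Suc)
qed

text \<open>
  Quotients by \<open>t ^ 4\<close> have the value \<open>0\<close> at the origin instead of their limit; a single point
  does not affect the integrals.
\<close>

lemma pos_type_cong_nonzero:
  assumes F: "pos_type C F" and eq: "\<And>t. t \<noteq> 0 \<Longrightarrow> G t = F t" and G0: "G 0 = 0"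
  shows "pos_type C G"
proof (rule pos_typeI)
  note [measurable] = pos_type_measurable[OF F]
  have G: "G = (\<lambda>t. if t = 0 then 0 else F t)" using eq G0 by (intro ext) (simp del: abs_0_eq)
  show [measurable]: "G \<in> borel_measurable borel" unfolding G by measurable
  show "\<bar>G t\<bar> \<le> C" for t
    using pos_type_abs_le[OF F, of t] pos_type_bound_nonneg[OF F] by (simp add: G)
  fix c u :: real assume "c > 0"
  have "AE t in lborel. G t * exp (- c * t\<^sup>2) * cos (t * u) = F t * exp (- c * t\<^sup>2) * cos (t * u)"
    using AE_lborel_singleton[of "0::real"] by eventually_elim (simp add: G)
  then have "(\<integral>t. G t * exp (- c * t\<^sup>2) * cos (t * u) \<partial>lborel)
      = (\<integral>t. F t * exp (- c * t\<^sup>2) * cos (t * u) \<partial>lborel)"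
    by (intro integral_cong_AE) measurable
  then show "0 \<le> (\<integral>t. G t * exp (- c * t\<^sup>2) * cos (t * u) \<partial>lborel)"
    using pos_type_transform_nonneg[OF F \<open>c > 0\<close>] by simp
qed

section \<open>Comparison of characteristic functions\<close>

lemma integral_Icc_FTC:
  fixes f F :: "real \<Rightarrow> real"
  assumes "l \<le> u" "\<And>x. (F has_real_derivative f x) (at x)" "\<And>x. isCont f x"
  shows "integrable lborel (\<lambda>x. f x * indicator {l..u} x)"
    and "(\<integral>x. f x * indicator {l..u} x \<partial>lborel) = F u - F l"
proof -
  show "integrable lborel (\<lambda>x. f x * indicator {l..u} x)"
    using borel_integrable_atLeastAtMost[of l u f] assms
    by (simp add: indicator_def of_bool_def if_distrib mult.commute cong: if_cong)
  show "(\<integral>x. f x * indicator {l..u} x \<partial>lborel) = F u - F l"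
    using assms by (intro integral_FTC_Icc_real) auto
qed

text \<open>
  Taylor's formula with integral remainder writes \<open>(exp (- b * v) - 1 + b * v) / v\<^sup>2\<close> as the
  mixture of the exponentials \<open>exp (- s * v)\<close> with weight \<open>b - s\<close> on \<open>{0..b}\<close>; for \<open>v = t\<^sup>2\<close>
  these are Gaussians. This is the comparison of one summand \<open>sqrt b * Z1\<close> with a Gaussian of the
  same variance.
\<close>

lemma pos_type_mult_exp_remainder:
  assumes F: "pos_type C F" and b: "b \<ge> 0"
  shows "pos_type (C * (b\<^sup>2 / 2)) (\<lambda>t. F t * (exp (- b * t\<^sup>2) - 1 + b * t\<^sup>2) / t ^ 4)"
proof -
  note [measurable] = pos_type_measurable[OF F]
  let ?w = "\<lambda>s. (b - s) * indicator {0..b} s"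
  have w: "integrable lborel ?w" "(\<integral>s. ?w s \<partial>lborel) = b\<^sup>2 / 2"
  proof -
    have der: "((\<lambda>s. b * s - s\<^sup>2 / 2) has_real_derivative b - s) (at s)" for s
      by (auto intro!: derivative_eq_intros)
    show "integrable lborel ?w" by (rule integral_Icc_FTC[OF b der]) auto
    have "(\<integral>s. ?w s \<partial>lborel) = (b * b - b\<^sup>2 / 2) - (b * 0 - 0\<^sup>2 / 2)"
      by (rule integral_Icc_FTC[OF b der]) auto
    then show "(\<integral>s. ?w s \<partial>lborel) = b\<^sup>2 / 2" by (simp add: power2_eq_square)
  qed
  have mix: "pos_type (C * (\<integral>s. ?w s \<partial>lborel)) (\<lambda>t. \<integral>s. ?w s * (F t * exp (- s * t\<^sup>2)) \<partial>lborel)"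
  proof (rule pos_type_mixture)
    show "(\<lambda>(s, t). F t * exp (- s * t\<^sup>2)) \<in> borel_measurable (borel \<Otimes>\<^sub>M borel)"
      by measurable
    show "0 \<le> ?w s" for s by (simp add: indicator_def)
    show "pos_type C (\<lambda>t. F t * exp (- s * t\<^sup>2))" if "?w s \<noteq> 0" for s
      using that by (intro pos_type_mult_gauss[OF F]) (simp add: indicator_def split: if_splits)
  qed (rule w pos_type_bound_nonneg[OF F])+
  have eq: "F t * (exp (- b * t\<^sup>2) - 1 + b * t\<^sup>2) / t ^ 4 = (\<integral>s. ?w s * (F t * exp (- s * t\<^sup>2)) \<partial>lborel)"
    if t: "t \<noteq> 0" for t
  proof -
    define v where "v = t\<^sup>2"
    have v: "v \<noteq> 0" "t ^ 4 = v\<^sup>2" using t by (auto simp: v_def power_mult[symmetric])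
    have der: "((\<lambda>s. - (b - s) * exp (- s * v) / v + exp (- s * v) / v\<^sup>2)
        has_real_derivative (b - s) * exp (- s * v)) (at s)" for s
      using v by (auto intro!: derivative_eq_intros simp: field_simps power2_eq_square)
    have "(\<integral>s. ?w s * (F t * exp (- s * t\<^sup>2)) \<partial>lborel)
        = (\<integral>s. F t * (((b - s) * exp (- s * v)) * indicator {0..b} s) \<partial>lborel)"
      by (simp only: v_def mult.assoc mult.left_commute mult.commute)
    also have "\<dots> = F t * (\<integral>s. ((b - s) * exp (- s * v)) * indicator {0..b} s \<partial>lborel)"
      by simp
    also have "(\<integral>s. ((b - s) * exp (- s * v)) * indicator {0..b} s \<partial>lborel)
        = (- (b - b) * exp (- b * v) / v + exp (- b * v) / v\<^sup>2) - (- (b - 0) * exp (- 0 * v) / v + exp (- 0 * v) / v\<^sup>2)"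
      by (rule integral_Icc_FTC[OF b der]) (auto intro!: continuous_intros)
    also have "\<dots> = (exp (- b * v) - 1 + b * v) / v\<^sup>2"
      using v by (simp add: field_simps power2_eq_square)
    finally show ?thesis by (simp add: v v_def[symmetric])
  qed
  show ?thesis
    using pos_type_cong_nonzero[OF mix eq] by (simp add: w)
qed

lemma pos_type_gauss: "c \<ge> 0 \<Longrightarrow> pos_type 1 (\<lambda>t. exp (- c * t\<^sup>2))"
  using pos_type_mult_gauss[OF pos_type_const[of 1], of c] by simp

text \<open>
  Each quadratic factor is paired with its own share \<open>exp (- b j * t\<^sup>2 / 2)\<close> of the Gaussian; the
  condition on the sum says that there is enough of it.
\<close>

lemma pos_type_gauss_prod:
  fixes b :: "nat \<Rightarrow> real"
  assumes b: "\<And>j. b j \<ge> 0" and "(\<Sum>j<n. b j) \<le> a"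
  shows "pos_type 1 (\<lambda>t. exp (- a * t\<^sup>2 / 2) * (\<Prod>j<n. 1 - b j * t\<^sup>2))"
  using assms(2)
proof (induction n arbitrary: a)
  case 0
  then show ?case using pos_type_gauss[of "a/2"] by simp
next
  case (Suc n)
  have "pos_type 1 (\<lambda>t. (exp (- (a - b n) * t\<^sup>2 / 2) * (\<Prod>j<n. 1 - b j * t\<^sup>2))
      * ((1 - b n * t\<^sup>2) * exp (- b n * t\<^sup>2 / 2)))"
    using Suc by (intro pos_type_mult_Z1_transform b Suc.IH) simp
  moreover have "(exp (- (a - b n) * t\<^sup>2 / 2) * (\<Prod>j<n. 1 - b j * t\<^sup>2)) * ((1 - b n * t\<^sup>2) * exp (- b n * t\<^sup>2 / 2))
     = exp (- a * t\<^sup>2 / 2) * (\<Prod>j<Suc n. 1 - b j * t\<^sup>2)" for t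
  proof -
    have "exp (- a * t\<^sup>2 / 2) = exp (- (a - b n) * t\<^sup>2 / 2) * exp (- b n * t\<^sup>2 / 2)"
      by (simp add: exp_add[symmetric] field_simps)
    then show ?thesis by (simp only: prod.lessThan_Suc mult_ac)
  qed
  ultimately show ?case by (simp only:)
qed

text \<open>
  The factors are exchanged for Gaussians one at a time: the difference for \<open>Suc n\<close> factors is the
  difference for \<open>n\<close> factors damped by \<open>exp (- b n * t\<^sup>2)\<close>, plus the characteristic function of the
  first \<open>n\<close> factors times a remainder covered by \<open>pos_type_mult_exp_remainder\<close>.
\<close>

lemma pos_type_gauss_minus_prod:
  fixes b :: "nat \<Rightarrow> real"
  assumes b: "\<And>j. b j \<ge> 0" and "(\<Sum>j<n. b j) \<le> a"
  shows "pos_type ((\<Sum>j<n. b j)\<^sup>2 / 2)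
    (\<lambda>t. (exp (- (a / 2 + (\<Sum>j<n. b j)) * t\<^sup>2) - exp (- a * t\<^sup>2 / 2) * (\<Prod>j<n. 1 - b j * t\<^sup>2)) / t ^ 4)"
  using assms(2)
proof (induction n)
  case 0
  then show ?case using pos_type_const[of 0] by simp
next
  case (Suc n)
  define B where "B = (\<Sum>j<n. b j)"
  define P where "P t = exp (- a * t\<^sup>2 / 2) * (\<Prod>j<n. 1 - b j * t\<^sup>2)" for t
  have le: "B \<le> a" "B \<ge> 0" using Suc.prems b[of n] by (auto simp: B_def intro: sum_nonneg b)
  have step: "pos_type (B\<^sup>2 / 2 + 1 * ((b n)\<^sup>2 / 2))
     (\<lambda>t. (exp (- (a / 2 + B) * t\<^sup>2) - P t) / t ^ 4 * exp (- b n * t\<^sup>2)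
        + P t * (exp (- b n * t\<^sup>2) - 1 + b n * t\<^sup>2) / t ^ 4)"
    using Suc.IH pos_type_gauss_prod[OF b] le b
    unfolding B_def P_def by (intro pos_type_add pos_type_mult_gauss pos_type_mult_exp_remainder) auto
  have eq: "(exp (- (a / 2 + B) * t\<^sup>2) - P t) / t ^ 4 * exp (- b n * t\<^sup>2)
        + P t * (exp (- b n * t\<^sup>2) - 1 + b n * t\<^sup>2) / t ^ 4
     = (exp (- (a / 2 + (B + b n)) * t\<^sup>2) - P t * (1 - b n * t\<^sup>2)) / t ^ 4" for t
  proof -
    have "exp (- (a / 2 + (B + b n)) * t\<^sup>2) = exp (- (a / 2 + B) * t\<^sup>2) * exp (- b n * t\<^sup>2)"
      by (simp add: exp_add[symmetric] algebra_simps)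
    then show ?thesis by (simp add: add_divide_distrib[symmetric] algebra_simps)
  qed
  have bound: "B\<^sup>2 / 2 + 1 * ((b n)\<^sup>2 / 2) \<le> (B + b n)\<^sup>2 / 2"
    using le b[of n] by (simp add: power2_sum)
  show ?case
    using pos_type_mono[OF step bound] unfolding eq by (simp add: B_def P_def mult.assoc)
qed

text \<open>
  Merging two factors loses only the quartic term:
  \<open>(1 - B * v) * (1 - b * v) = (1 - (B + b) * v) + B * b * v\<^sup>2\<close>. In the induction the difference for
  \<open>n\<close> factors gets multiplied by a further factor, which has to take a part of the Gaussian with it;
  hence the induction hypothesis is needed for the smaller exponent \<open>a - b n\<close>.
\<close>

lemma pos_type_prod_minus_linear:
  fixes b :: "nat \<Rightarrow> real"
  assumes b: "\<And>j. b j \<ge> 0" and "(\<Sum>j<n. b j) \<le> a"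
  shows "pos_type ((\<Sum>j<n. b j)\<^sup>2)
    (\<lambda>t. exp (- a * t\<^sup>2 / 2) * ((\<Prod>j<n. 1 - b j * t\<^sup>2) - (1 - (\<Sum>j<n. b j) * t\<^sup>2)) / t ^ 4)"
  using assms(2)
proof (induction n arbitrary: a)
  case 0
  then show ?case using pos_type_const[of 0] by simp
next
  case (Suc n)
  define B where "B = (\<Sum>j<n. b j)"
  define P where "P t = (\<Prod>j<n. 1 - b j * t\<^sup>2)" for t
  have le: "B + b n \<le> a" "B \<ge> 0" using Suc.prems by (auto simp: B_def intro: sum_nonneg b)
  have IH: "pos_type (B\<^sup>2) (\<lambda>t. exp (- (a - b n) * t\<^sup>2 / 2) * (P t - (1 - B * t\<^sup>2)) / t ^ 4)"
    using Suc.IH[of "a - b n"] le unfolding B_def P_def by simp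
  have rest: "pos_type (B * b n) (\<lambda>t. (B * b n) * exp (- (a / 2) * t\<^sup>2))"
    using le b by (intro pos_type_mult_gauss pos_type_const) (auto intro: order_trans[OF add_nonneg_nonneg])
  have "pos_type (B\<^sup>2 + B * b n)
     (\<lambda>t. exp (- (a - b n) * t\<^sup>2 / 2) * (P t - (1 - B * t\<^sup>2)) / t ^ 4 * ((1 - b n * t\<^sup>2) * exp (- b n * t\<^sup>2 / 2))
        + (B * b n) * exp (- (a / 2) * t\<^sup>2))"
    by (rule pos_type_add[OF pos_type_mult_Z1_transform[OF IH b] rest])
  then have "pos_type (B\<^sup>2 + B * b n)
     (\<lambda>t. exp (- a * t\<^sup>2 / 2) * (P t * (1 - b n * t\<^sup>2) - (1 - (B + b n) * t\<^sup>2)) / t ^ 4)"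
  proof (rule pos_type_cong_nonzero)
    fix t :: real assume t: "t \<noteq> 0"
    have e: "exp (- a * t\<^sup>2 / 2) = exp (- (a - b n) * t\<^sup>2 / 2) * exp (- b n * t\<^sup>2 / 2)"
      by (simp add: exp_add[symmetric] field_simps)
    have "exp (- (a / 2) * t\<^sup>2) = exp (- a * t\<^sup>2 / 2)" by simp
    then show "exp (- a * t\<^sup>2 / 2) * (P t * (1 - b n * t\<^sup>2) - (1 - (B + b n) * t\<^sup>2)) / t ^ 4
      = exp (- (a - b n) * t\<^sup>2 / 2) * (P t - (1 - B * t\<^sup>2)) / t ^ 4 * ((1 - b n * t\<^sup>2) * exp (- b n * t\<^sup>2 / 2))
        + (B * b n) * exp (- (a / 2) * t\<^sup>2)"
      unfolding e using t by (simp add: field_simps eval_nat_numeral)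
  qed simp
  then have "pos_type ((B + b n)\<^sup>2)
     (\<lambda>t. exp (- a * t\<^sup>2 / 2) * (P t * (1 - b n * t\<^sup>2) - (1 - (B + b n) * t\<^sup>2)) / t ^ 4)"
    by (rule pos_type_mono) (use le b[of n] in \<open>simp add: power2_sum\<close>)
  then show ?case by (simp add: B_def P_def)
qed

text \<open>
  Along the family \<open>(1 - r * v) * exp (- (3 * s - 2 * r) * v / 2)\<close>, whose members all have variance
  \<open>3 * s\<close>, the derivative in \<open>r\<close> is \<open>- r * v\<^sup>2\<close> times a Gaussian. Moving variance from the Gaussian
  part into the linear factor therefore lowers the function, until \<open>r = s\<close> leaves the law of
  \<open>sqrt s * Z1\<close>.
\<close>

lemma pos_type_linear_factor_antimono:
  fixes B s :: real
  assumes B: "0 \<le> B" "B \<le> s"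
  shows "pos_type ((s\<^sup>2 - B\<^sup>2) / 2)
    (\<lambda>t. (exp (- (3 * s - 2 * B) * t\<^sup>2 / 2) * (1 - B * t\<^sup>2) - exp (- s * t\<^sup>2 / 2) * (1 - s * t\<^sup>2)) / t ^ 4)"
proof -
  let ?w = "\<lambda>r. r * indicator {B..s} r"
  have w: "integrable lborel ?w" "(\<integral>r. ?w r \<partial>lborel) = (s\<^sup>2 - B\<^sup>2) / 2"
  proof -
    have der: "((\<lambda>r. r\<^sup>2 / 2) has_real_derivative r) (at r)" for r :: real
      by (auto intro!: derivative_eq_intros)
    show "integrable lborel ?w" by (rule integral_Icc_FTC[OF B(2) der]) auto
    have "(\<integral>r. ?w r \<partial>lborel) = s\<^sup>2 / 2 - B\<^sup>2 / 2"
      by (rule integral_Icc_FTC[OF B(2) der]) auto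
    then show "(\<integral>r. ?w r \<partial>lborel) = (s\<^sup>2 - B\<^sup>2) / 2" by (simp add: diff_divide_distrib)
  qed
  have mix: "pos_type (1 * (\<integral>r. ?w r \<partial>lborel)) (\<lambda>t. \<integral>r. ?w r * exp (- ((3 * s - 2 * r) / 2) * t\<^sup>2) \<partial>lborel)"
  proof (rule pos_type_mixture)
    show "(\<lambda>(r, t). exp (- ((3 * s - 2 * r) / 2) * t\<^sup>2)) \<in> borel_measurable (borel \<Otimes>\<^sub>M borel)"
      by measurable
    show "0 \<le> ?w r" for r using B by (simp add: indicator_def)
    show "pos_type 1 (\<lambda>t. exp (- ((3 * s - 2 * r) / 2) * t\<^sup>2))" if "?w r \<noteq> 0" for r
      using that B by (intro pos_type_gauss) (simp add: indicator_def split: if_splits)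
  qed (rule w zero_le_one)+
  have eq: "(exp (- (3 * s - 2 * B) * t\<^sup>2 / 2) * (1 - B * t\<^sup>2) - exp (- s * t\<^sup>2 / 2) * (1 - s * t\<^sup>2)) / t ^ 4
      = (\<integral>r. ?w r * exp (- ((3 * s - 2 * r) / 2) * t\<^sup>2) \<partial>lborel)"
    if t: "t \<noteq> 0" for t
  proof -
    define v where "v = t\<^sup>2"
    have v: "v \<noteq> 0" "t ^ 4 = v\<^sup>2" using t by (auto simp: v_def power_mult[symmetric])
    define H where "H r = - (1 - r * v) * exp (- ((3 * s - 2 * r) / 2) * v) / v\<^sup>2" for r
    have der: "(H has_real_derivative r * exp (- ((3 * s - 2 * r) / 2) * v)) (at r)" for r
      unfolding H_def[abs_def] using v
      by (auto intro!: derivative_eq_intros simp: field_simps power2_eq_square)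
    have "(\<integral>r. ?w r * exp (- ((3 * s - 2 * r) / 2) * t\<^sup>2) \<partial>lborel)
        = (\<integral>r. (r * exp (- ((3 * s - 2 * r) / 2) * v)) * indicator {B..s} r \<partial>lborel)"
      by (simp only: v_def mult.assoc mult.left_commute mult.commute)
    also have "\<dots> = H s - H B"
      by (rule integral_Icc_FTC[OF B(2) der]) (auto intro!: continuous_intros)
    also have "H s - H B = (exp (- (3 * s - 2 * B) * v / 2) * (1 - B * v) - exp (- s * v / 2) * (1 - s * v)) / v\<^sup>2"
    proof -
      have "- ((3 * s - 2 * s) / 2) * v = - s * v / 2" "- ((3 * s - 2 * B) / 2) * v = - (3 * s - 2 * B) * v / 2"
        by (simp_all add: field_simps)
      moreover have "- x * p / w - - y * q / w = (q * y - p * x) / w" for x y p q w :: real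
        by (simp add: diff_divide_distrib mult.commute)
      ultimately show ?thesis by (simp only: H_def)
    qed
    finally show ?thesis by (simp add: v v_def[symmetric])
  qed
  show ?thesis
    using pos_type_cong_nonzero[OF mix eq] by (simp add: w)
qed

lemma prod_one_minus_tendsto:
  fixes b :: "nat \<Rightarrow> real"
  assumes "summable b" "\<And>j. b j \<ge> 0"
  shows "(\<lambda>n. \<Prod>j<n. 1 - b j * v) \<longlonglongrightarrow> (\<Prod>j. 1 - b j * v)"
proof -
  have "summable (\<lambda>j. norm ((1 - b j * v) - 1))"
    using summable_mult2[OF assms(1), of "\<bar>v\<bar>"] assms(2) by (simp add: abs_mult)
  then have "convergent_prod (\<lambda>j. 1 - b j * v)"
    by (intro abs_convergent_prod_imp_convergent_prod summable_imp_abs_convergent_prod)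
  then have "(\<lambda>n. \<Prod>j\<le>n. 1 - b j * v) \<longlonglongrightarrow> (\<Prod>j. 1 - b j * v)"
    by (rule convergent_prod_LIMSEQ)
  then show ?thesis
    by (rule LIMSEQ_lessThan_iff_atMost[THEN iffD2])
qed

context
  fixes b :: "nat \<Rightarrow> real" and a B :: real
  assumes b: "summable b" "\<And>j. b j \<ge> 0" and a: "(\<Sum>j. b j) \<le> a" and B: "B = (\<Sum>j. b j)"
begin

lemma partial_sum_tendsto: "(\<lambda>n. \<Sum>j<n. b j) \<longlonglongrightarrow> B"
  unfolding B by (rule summable_LIMSEQ[OF b(1)])

lemma partial_sum_bounds: "0 \<le> (\<Sum>j<n. b j)" "(\<Sum>j<n. b j) \<le> a"
  using sum_le_suminf[OF b(1), of "{..<n}"] b(2) a by (auto intro: sum_nonneg)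

lemma pos_type_gauss_minus_infinite_prod:
  "pos_type (a\<^sup>2 / 2)
     (\<lambda>t. (exp (- (a / 2 + B) * t\<^sup>2) - exp (- a * t\<^sup>2 / 2) * (\<Prod>j. 1 - b j * t\<^sup>2)) / t ^ 4)"
proof (rule pos_type_limit)
  show "pos_type (a\<^sup>2 / 2) (\<lambda>t. (exp (- (a / 2 + (\<Sum>j<n. b j)) * t\<^sup>2)
      - exp (- a * t\<^sup>2 / 2) * (\<Prod>j<n. 1 - b j * t\<^sup>2)) / t ^ 4)" for n
    by (rule pos_type_mono[OF pos_type_gauss_minus_prod[OF b(2)]])
       (use partial_sum_bounds[of n] in \<open>auto intro: power_mono\<close>)
  show "(\<lambda>n. (exp (- (a / 2 + (\<Sum>j<n. b j)) * t\<^sup>2) - exp (- a * t\<^sup>2 / 2) * (\<Prod>j<n. 1 - b j * t\<^sup>2)) / t ^ 4)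
    \<longlonglongrightarrow> (exp (- (a / 2 + B) * t\<^sup>2) - exp (- a * t\<^sup>2 / 2) * (\<Prod>j. 1 - b j * t\<^sup>2)) / t ^ 4" for t
  proof (cases "t = 0")
    case False
    then show ?thesis
      by (intro tendsto_intros partial_sum_tendsto prod_one_minus_tendsto b) simp
  qed simp
qed

text \<open>
  For finitely many factors the two previous comparisons are chained: all factors are first merged
  into the single factor \<open>1 - S n * t\<^sup>2\<close>, which is then compared with the extremal one of the same
  variance \<open>3 * r n\<close>. Both bounds are uniform in \<open>n\<close>.
\<close>

lemma pos_type_infinite_prod_minus_linear:
  assumes s: "s = (a + 2 * B) / 3"
  shows "pos_type (2 * a\<^sup>2)
     (\<lambda>t. (exp (- a * t\<^sup>2 / 2) * (\<Prod>j. 1 - b j * t\<^sup>2) - exp (- s * t\<^sup>2 / 2) * (1 - s * t\<^sup>2)) / t ^ 4)"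
proof (rule pos_type_limit)
  define S where "S n = (\<Sum>j<n. b j)" for n
  define r where "r n = (a + 2 * S n) / 3" for n
  show "pos_type (2 * a\<^sup>2) (\<lambda>t. (exp (- a * t\<^sup>2 / 2) * (\<Prod>j<n. 1 - b j * t\<^sup>2)
      - exp (- r n * t\<^sup>2 / 2) * (1 - r n * t\<^sup>2)) / t ^ 4)" for n
  proof -
    have S: "0 \<le> S n" "S n \<le> a" using partial_sum_bounds[of n] by (auto simp: S_def)
    then have r: "S n \<le> r n" "0 \<le> r n" "r n \<le> a" "3 * r n - 2 * S n = a" by (auto simp: r_def field_simps)
    have "pos_type ((S n)\<^sup>2 + ((r n)\<^sup>2 - (S n)\<^sup>2) / 2)
      (\<lambda>t. exp (- a * t\<^sup>2 / 2) * ((\<Prod>j<n. 1 - b j * t\<^sup>2) - (1 - S n * t\<^sup>2)) / t ^ 4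
        + (exp (- (3 * r n - 2 * S n) * t\<^sup>2 / 2) * (1 - S n * t\<^sup>2) - exp (- r n * t\<^sup>2 / 2) * (1 - r n * t\<^sup>2)) / t ^ 4)"
      using S r unfolding S_def
      by (intro pos_type_add pos_type_prod_minus_linear pos_type_linear_factor_antimono b) auto
    moreover have "(S n)\<^sup>2 + ((r n)\<^sup>2 - (S n)\<^sup>2) / 2 \<le> 2 * a\<^sup>2"
    proof -
      have "(S n)\<^sup>2 \<le> a\<^sup>2" "(r n)\<^sup>2 \<le> a\<^sup>2" using S r by (auto intro: power_mono)
      then show ?thesis using zero_le_power2[of "S n"] zero_le_power2[of a] by argo
    qed
    ultimately show ?thesis
      unfolding r(4) add_divide_distrib[symmetric]
      by (auto dest: pos_type_mono simp: algebra_simps)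
  qed
  have Sl: "S \<longlonglongrightarrow> B" using partial_sum_tendsto by (simp add: S_def[abs_def])
  have rl: "r \<longlonglongrightarrow> s" unfolding r_def[abs_def] s by (intro tendsto_intros Sl) simp
  show "(\<lambda>n. (exp (- a * t\<^sup>2 / 2) * (\<Prod>j<n. 1 - b j * t\<^sup>2) - exp (- r n * t\<^sup>2 / 2) * (1 - r n * t\<^sup>2)) / t ^ 4)
    \<longlonglongrightarrow> (exp (- a * t\<^sup>2 / 2) * (\<Prod>j. 1 - b j * t\<^sup>2) - exp (- s * t\<^sup>2 / 2) * (1 - s * t\<^sup>2)) / t ^ 4" for t
  proof (cases "t = 0")
    case False
    then show ?thesis
      by (intro tendsto_intros rl prod_one_minus_tendsto b) simp_all
  qed simp
qed

end

section \<open>Third absolute moments from the cosine transform\<close>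

text \<open>
  Up to the scaling \<open>v = x * t\<close>, the kernel in the formula that represents \<open>\<bar>x\<bar> ^ 3\<close> as an integral
  of cosines. Its integral is a positive constant, and its value does not matter for comparisons.
\<close>

definition cos_remainder :: "real \<Rightarrow> real" where
  "cos_remainder v = (cos v - 1 + v\<^sup>2 / 2) / v ^ 4"

definition cube_const :: real where
  "cube_const = (\<integral>v. cos_remainder v \<partial>lborel)"

lemma cos_quadratic_lower: "1 - v\<^sup>2 / 2 \<le> cos (v::real)"
proof -
  have "(sin (v / 2))\<^sup>2 \<le> (v / 2)\<^sup>2"
    using abs_sin_x_le_abs_x[of "v/2"] by (simp only: abs_le_square_iff)
  moreover have "cos v = 1 - 2 * (sin (v / 2))\<^sup>2"
    using cos_double_sin[of "v/2"] by simp
  ultimately show ?thesis by (simp add: power_divide)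
qed

lemma cos_quartic_upper: "cos (v::real) - 1 + v\<^sup>2 / 2 \<le> v ^ 4 / 24"
proof -
  have "\<bar>Re (iexp v - (\<Sum>k\<le>3. (\<i> * v) ^ k / fact k))\<bar> \<le> \<bar>v\<bar> ^ Suc 3 / fact (Suc 3)"
    by (rule order_trans[OF abs_Re_le_cmod iexp_approx1])
  moreover have "Re (iexp v - (\<Sum>k\<le>3. (\<i> * v) ^ k / fact k)) = cos v - 1 + v\<^sup>2 / 2"
    by (simp add: eval_nat_numeral Re_exp)
  moreover have "\<bar>v\<bar> ^ Suc 3 / fact (Suc 3) = v ^ 4 / 24"
    by (simp add: fact_numeral)
  ultimately show ?thesis by linarith
qed

lemma cos_remainder_nonneg: "0 \<le> cos_remainder v"
  using cos_quadratic_lower[of v] by (simp add: cos_remainder_def)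

lemma cos_remainder_le: "cos_remainder v \<le> inverse (1 + v\<^sup>2)"
proof (cases "\<bar>v\<bar> \<le> 1")
  case True
  have "cos_remainder v \<le> 1 / 24"
    using cos_quartic_upper[of v] by (cases "v = 0") (auto simp: cos_remainder_def field_simps)
  also have "1 / 24 \<le> inverse (1 + v\<^sup>2)"
    using abs_square_le_1[of v] True by (simp add: field_simps add_pos_nonneg)
  finally show ?thesis .
next
  case False
  then have v: "v \<noteq> 0" "v\<^sup>2 \<ge> 1" using abs_le_square_iff[of 1 v] by auto
  have "cos_remainder v \<le> (v\<^sup>2 / 2) / v ^ 4"
    unfolding cos_remainder_def by (intro divide_right_mono) (auto simp: zero_le_power_eq)
  also have "\<dots> = inverse (2 * v\<^sup>2)"
    using v by (simp add: field_simps eval_nat_numeral)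
  also have "\<dots> \<le> inverse (1 + v\<^sup>2)"
    using v by (intro le_imp_inverse_le) (auto intro: add_pos_nonneg)
  finally show ?thesis .
qed

lemma borel_measurable_cos_remainder[measurable]: "cos_remainder \<in> borel_measurable borel"
  unfolding cos_remainder_def[abs_def] by measurable

lemma integrable_cos_remainder: "integrable lborel cos_remainder"
proof (rule Bochner_Integration.integrable_bound)
  show "integrable lborel (\<lambda>x::real. inverse (1 + x\<^sup>2))"
    using integrable_inverse_1_plus_square by (simp add: set_integrable_def)
  show "AE v in lborel. norm (cos_remainder v) \<le> norm (inverse (1 + v\<^sup>2))"
    using cos_remainder_nonneg cos_remainder_le by (auto intro!: AE_I2 order_trans[OF _ abs_ge_self])
qed simp

lemma cube_const_pos: "0 < cube_const"
proof -
  \<comment> \<open>On \<open>{4..5}\<close> the numerator is at least \<open>- 1 - 1 + 16 / 2\<close> and the denominator at most \<open>5 ^ 4\<close>.\<close>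
  have "0 < (\<integral>v. (6 / 625) * indicator {4..5::real} v \<partial>lborel :: real)" by simp
  also have "\<dots> \<le> cube_const"
    unfolding cube_const_def
  proof (rule integral_mono)
    fix v :: real
    show "(6 / 625) * indicator {4..5} v \<le> cos_remainder v"
    proof (cases "v \<in> {4..5}")
      case True
      then have "v ^ 4 \<le> 5 ^ 4" "4\<^sup>2 \<le> v\<^sup>2"
        using power_mono[of v 5 4] power_mono[of 4 v 2] by simp_all
      then have v: "v ^ 4 \<le> 625" "16 \<le> v\<^sup>2" "0 < v ^ 4" using True by simp_all
      then have "6 \<le> cos v - 1 + v\<^sup>2 / 2" using cos_ge_minus_one[of v] by linarith
      then have "6 / 625 \<le> (cos v - 1 + v\<^sup>2 / 2) / v ^ 4"
        by (intro frac_le) (use v in auto)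
      then show ?thesis using True by (simp add: cos_remainder_def)
    qed (simp add: cos_remainder_nonneg)
  qed (auto simp: integrable_cos_remainder)
  finally show ?thesis .
qed

text \<open>
  The substitution \<open>v = x * t\<close> produces the power \<open>x ^ 4 / \<bar>x\<bar>\<close>.
\<close>

lemma abs_cube_eq_cos_integral:
  fixes x :: real
  shows "integrable lborel (\<lambda>t. (cos (x * t) - 1 + (x * t)\<^sup>2 / 2) / t ^ 4)" (is "integrable lborel ?f")
    and "(\<integral>t. (cos (x * t) - 1 + (x * t)\<^sup>2 / 2) / t ^ 4 \<partial>lborel) = cube_const * \<bar>x\<bar> ^ 3"
proof -
  have "integrable lborel ?f \<and> (\<integral>t. ?f t \<partial>lborel) = cube_const * \<bar>x\<bar> ^ 3"
  proof (cases "x = 0")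
    case False
    have f: "?f = (\<lambda>t. x ^ 4 * cos_remainder (0 + x * t))"
      using False by (auto simp: cos_remainder_def fun_eq_iff power_mult_distrib)
    have "integrable lborel (\<lambda>t. cos_remainder (0 + x * t))"
      by (rule lborel_integrable_real_affine[OF integrable_cos_remainder False])
    moreover have "cube_const = \<bar>x\<bar> *\<^sub>R (\<integral>t. cos_remainder (0 + x * t) \<partial>lborel)"
      unfolding cube_const_def by (rule lborel_integral_real_affine[OF False])
    moreover have "x ^ 4 = \<bar>x\<bar> ^ 3 * \<bar>x\<bar>"
      using power_Suc2[of "\<bar>x\<bar>" 3] by simp
    ultimately show ?thesis unfolding f by simp
  qed simp
  then show "integrable lborel ?f" "(\<integral>t. ?f t \<partial>lborel) = cube_const * \<bar>x\<bar> ^ 3" by auto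
qed

text \<open>
  All that the comparison uses about the law of a random variable; two variables are compared
  when they share the second moment \<open>m\<close>. Only the real part of the characteristic function
  appears because the functions to be integrated are even.
\<close>

definition cos_law :: "'a measure \<Rightarrow> ('a \<Rightarrow> real) \<Rightarrow> real \<Rightarrow> (real \<Rightarrow> real) \<Rightarrow> bool" where
  "cos_law M X m \<phi> \<longleftrightarrow> prob_space M \<and> X \<in> borel_measurable M \<and> integrable M (\<lambda>w. \<bar>X w\<bar> ^ 3)
     \<and> (\<integral>w. (X w)\<^sup>2 \<partial>M) = m \<and> (\<forall>t. (\<integral>w. cos (t * X w) \<partial>M) = \<phi> t)"

lemma cos_law_integrable_square:
  assumes "cos_law M X m \<phi>"
  shows "integrable M (\<lambda>w. (X w)\<^sup>2)"
proof -
  interpret prob_space M using assms by (simp add: cos_law_def)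
  have [measurable]: "X \<in> borel_measurable M" using assms by (simp add: cos_law_def)
  have le: "x\<^sup>2 \<le> 1 + \<bar>x\<bar> ^ 3" for x :: real
  proof (cases "\<bar>x\<bar> \<le> 1")
    case True then show ?thesis by (simp add: abs_square_le_1 add_increasing2)
  next
    case False
    then have "\<bar>x\<bar> ^ 2 \<le> \<bar>x\<bar> ^ 3" by (intro power_increasing) auto
    then show ?thesis by simp
  qed
  show ?thesis
  proof (rule Bochner_Integration.integrable_bound)
    show "integrable M (\<lambda>w. 1 + \<bar>X w\<bar> ^ 3)" using assms by (simp add: cos_law_def)
  qed (use le in auto)
qed

lemma cos_law_integrable_shifted_cube:
  assumes "cos_law M X m \<phi>"
  shows "integrable M (\<lambda>w. \<bar>X w + u\<bar> ^ 3)"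
proof -
  interpret prob_space M using assms by (simp add: cos_law_def)
  have [measurable]: "X \<in> borel_measurable M" using assms by (simp add: cos_law_def)
  have le: "\<bar>x + u\<bar> ^ 3 \<le> 8 * \<bar>x\<bar> ^ 3 + 8 * \<bar>u\<bar> ^ 3" for x
  proof -
    have "\<bar>x + u\<bar> ^ 3 \<le> (2 * max \<bar>x\<bar> \<bar>u\<bar>) ^ 3" by (intro power_mono) auto
    also have "\<dots> = 8 * (max \<bar>x\<bar> \<bar>u\<bar>) ^ 3" by (simp add: power_mult_distrib)
    also have "\<dots> \<le> 8 * \<bar>x\<bar> ^ 3 + 8 * \<bar>u\<bar> ^ 3" by (simp add: max_def)
    finally show ?thesis .
  qed
  show ?thesis
  proof (rule Bochner_Integration.integrable_bound)
    show "integrable M (\<lambda>w. 8 * \<bar>X w\<bar> ^ 3 + 8 * \<bar>u\<bar> ^ 3)" using assms by (simp add: cos_law_def)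
  qed (use le in auto)
qed

text \<open>
  The formula for \<open>\<bar>x\<bar> ^ 3\<close> is applied at \<open>X w - u\<close> and \<open>X w + u\<close> and integrated over \<open>w\<close>. Adding
  the two shifts leaves only cosines of \<open>t * X w\<close> and even moments, and the integrand is nonnegative,
  so that Fubini's theorem applies without further estimates.
\<close>

lemma cos_law_cube_formula:
  assumes law: "cos_law M X m \<phi>"
  shows "integrable lborel (\<lambda>t. (2 * cos (t * u) * \<phi> t - 2 + t\<^sup>2 * (m + u\<^sup>2)) / t ^ 4)" (is "integrable lborel ?g")
    and "(\<integral>t. (2 * cos (t * u) * \<phi> t - 2 + t\<^sup>2 * (m + u\<^sup>2)) / t ^ 4 \<partial>lborel)
      = cube_const * ((\<integral>w. \<bar>X w - u\<bar> ^ 3 \<partial>M) + (\<integral>w. \<bar>X w + u\<bar> ^ 3 \<partial>M))"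
proof -
  interpret prob_space M using law by (simp add: cos_law_def)
  interpret pair_sigma_finite M lborel ..
  have X[measurable]: "X \<in> borel_measurable M" using law by (simp add: cos_law_def)
  define q where "q x t = (cos (x * t) - 1 + (x * t)\<^sup>2 / 2) / t ^ 4" for x t :: real
  define f where "f w t = q (X w - u) t + q (X w + u) t" for w t
  have q_nonneg: "0 \<le> q x t" for x t
    using cos_quadratic_lower[of "x * t"] by (simp add: q_def)
  have q_int: "integrable lborel (q x)" "(\<integral>t. q x t \<partial>lborel) = cube_const * \<bar>x\<bar> ^ 3" for x
    using abs_cube_eq_cos_integral[of x] by (simp_all add: q_def[abs_def])
  have cubes: "integrable M (\<lambda>w. \<bar>X w - u\<bar> ^ 3)" "integrable M (\<lambda>w. \<bar>X w + u\<bar> ^ 3)"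
    using cos_law_integrable_shifted_cube[OF law, of u] cos_law_integrable_shifted_cube[OF law, of "-u"] by simp_all
  have f_meas: "(\<lambda>(w, t). f w t) \<in> borel_measurable (M \<Otimes>\<^sub>M lborel)"
    unfolding f_def q_def by measurable
  have f_inner: "(\<integral>t. f w t \<partial>lborel) = cube_const * (\<bar>X w - u\<bar> ^ 3 + \<bar>X w + u\<bar> ^ 3)" for w
    unfolding f_def using q_int by (simp add: distrib_left)
  have f_int: "integrable (M \<Otimes>\<^sub>M lborel) (\<lambda>(w, t). f w t)"
  proof (rule Fubini_integrable[OF f_meas])
    have "(\<integral>t. norm (case (w, t) of (w, t) \<Rightarrow> f w t) \<partial>lborel) = (\<integral>t. f w t \<partial>lborel)" for w
      using q_nonneg by (simp add: f_def)
    then show "integrable M (\<lambda>w. \<integral>t. norm (case (w, t) of (w, t) \<Rightarrow> f w t) \<partial>lborel)"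
      using cubes by (simp add: f_inner)
    show "AE w in M. integrable lborel (\<lambda>t. case (w, t) of (w, t) \<Rightarrow> f w t)"
      using q_int by (simp add: f_def)
  qed
  have f_outer: "(\<integral>w. f w t \<partial>M) = ?g t" for t
  proof -
    have f_eq: "f w t = (2 * cos (t * u) * cos (t * X w) - 2 + t\<^sup>2 * ((X w)\<^sup>2 + u\<^sup>2)) / t ^ 4" for w
    proof -
      have "cos ((X w - u) * t) + cos ((X w + u) * t) = 2 * cos (t * u) * cos (t * X w)"
        by (simp add: algebra_simps cos_add cos_diff)
      moreover have "((X w - u) * t)\<^sup>2 / 2 + ((X w + u) * t)\<^sup>2 / 2 = t\<^sup>2 * ((X w)\<^sup>2 + u\<^sup>2)"
        by (simp add: power2_eq_square field_simps)
      ultimately show ?thesis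
        unfolding f_def q_def add_divide_distrib[symmetric] by (intro arg_cong2[where f = "(/)"]) auto
    qed
    have "integrable M (\<lambda>w. cos (t * X w))"
      by (rule integrable_const_bound[where B = 1]) auto
    then have "(\<integral>w. 2 * cos (t * u) * cos (t * X w) - 2 + t\<^sup>2 * ((X w)\<^sup>2 + u\<^sup>2) \<partial>M)
       = 2 * cos (t * u) * \<phi> t - 2 + t\<^sup>2 * (m + u\<^sup>2)"
      using cos_law_integrable_square[OF law] law by (simp add: cos_law_def prob_space)
    then show ?thesis unfolding f_eq by simp
  qed
  show "integrable lborel ?g"
    using integrable_snd[OF f_int] by (simp add: f_outer)
  have "(\<integral>t. ?g t \<partial>lborel) = (\<integral>t. (\<integral>w. f w t \<partial>M) \<partial>lborel)" by (simp add: f_outer)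
  also have "\<dots> = (\<integral>w. (\<integral>t. f w t \<partial>lborel) \<partial>M)" by (rule Fubini_integral[OF f_int])
  also have "\<dots> = cube_const * ((\<integral>w. \<bar>X w - u\<bar> ^ 3 \<partial>M) + (\<integral>w. \<bar>X w + u\<bar> ^ 3 \<partial>M))"
    using cubes by (simp add: f_inner)
  finally show "(\<integral>t. ?g t \<partial>lborel) = cube_const * ((\<integral>w. \<bar>X w - u\<bar> ^ 3 \<partial>M) + (\<integral>w. \<bar>X w + u\<bar> ^ 3 \<partial>M))" .
qed

section \<open>Comparison of truncated cubes\<close>

text \<open>
  The kernels whose fourth derivative, for \<open>u > 0\<close>, is a multiple of the sum of the point masses
  at \<open>u\<close> and \<open>- u\<close>.
\<close>

definition trunc_cube :: "real \<Rightarrow> real \<Rightarrow> real" where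
  "trunc_cube u x = (max 0 (\<bar>x\<bar> - u)) ^ 3"

lemma trunc_cube_nonneg: "0 \<le> trunc_cube u x"
  by (simp add: trunc_cube_def)

lemma trunc_cube_eq:
  assumes "u \<ge> 0"
  shows "trunc_cube u x = (\<bar>x - u\<bar> ^ 3 + \<bar>x + u\<bar> ^ 3) / 2 - 3 * u * x\<^sup>2 - u ^ 3"
proof -
  consider "u \<le> x" | "x \<le> - u" | "\<bar>x\<bar> \<le> u" using assms by linarith
  then show ?thesis
  proof cases
    case 1
    then show ?thesis using assms
      by (simp add: trunc_cube_def max_def power3_eq_cube power2_eq_square algebra_simps)
  next
    case 2
    then have "\<bar>x\<bar> = - x" "\<bar>x - u\<bar> = u - x" "\<bar>x + u\<bar> = - x - u" using assms by auto
    then show ?thesis using 2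
      by (simp add: trunc_cube_def max_def power3_eq_cube power2_eq_square algebra_simps)
  next
    case 3
    then have "max 0 (\<bar>x\<bar> - u) = 0" "\<bar>x - u\<bar> = u - x" "\<bar>x + u\<bar> = x + u" using assms by auto
    then show ?thesis
      by (simp add: trunc_cube_def power3_eq_cube power2_eq_square algebra_simps)
  qed
qed

lemma cos_law_trunc_cube:
  assumes law: "cos_law M X m \<phi>" and u: "u \<ge> 0"
  shows "integrable M (\<lambda>w. trunc_cube u (X w))"
    and "2 * cube_const * (\<integral>w. trunc_cube u (X w) \<partial>M)
      = (\<integral>t. (2 * cos (t * u) * \<phi> t - 2 + t\<^sup>2 * (m + u\<^sup>2)) / t ^ 4 \<partial>lborel)
        - 2 * cube_const * (3 * u * m + u ^ 3)"
proof -
  interpret prob_space M using law by (simp add: cos_law_def)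
  have cubes: "integrable M (\<lambda>w. \<bar>X w - u\<bar> ^ 3)" "integrable M (\<lambda>w. \<bar>X w + u\<bar> ^ 3)"
    using cos_law_integrable_shifted_cube[OF law, of u] cos_law_integrable_shifted_cube[OF law, of "-u"] by simp_all
  note sq = cos_law_integrable_square[OF law]
  have m: "(\<integral>w. (X w)\<^sup>2 \<partial>M) = m" using law by (simp add: cos_law_def)
  show "integrable M (\<lambda>w. trunc_cube u (X w))"
    unfolding trunc_cube_eq[OF u] using cubes sq by simp
  have expectation: "(\<integral>w. trunc_cube u (X w) \<partial>M)
      = ((\<integral>w. \<bar>X w - u\<bar> ^ 3 \<partial>M) + (\<integral>w. \<bar>X w + u\<bar> ^ 3 \<partial>M)) / 2 - 3 * u * m - u ^ 3"
    unfolding trunc_cube_eq[OF u] using cubes sq by (simp add: m prob_space)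
  show "2 * cube_const * (\<integral>w. trunc_cube u (X w) \<partial>M)
      = (\<integral>t. (2 * cos (t * u) * \<phi> t - 2 + t\<^sup>2 * (m + u\<^sup>2)) / t ^ 4 \<partial>lborel)
        - 2 * cube_const * (3 * u * m + u ^ 3)"
    unfolding cos_law_cube_formula(2)[OF law] expectation by (simp add: algebra_simps)
qed

text \<open>
  With equal second moments every term of the cube formula cancels except
  \<open>2 * (\<psi> t - \<phi> t) / t ^ 4 * cos (t * u)\<close>. The case \<open>u = 0\<close> of the same formula shows that
  \<open>(\<psi> t - \<phi> t) / t ^ 4\<close> is integrable, which the undamped transform requires.
\<close>

lemma trunc_cube_mono:
  assumes X: "cos_law M X m \<phi>" and Y: "cos_law N Y m \<psi>"
    and pos: "pos_type C (\<lambda>t. (\<psi> t - \<phi> t) / t ^ 4)" and u: "u \<ge> 0"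
  shows "(\<integral>w. trunc_cube u (X w) \<partial>M) \<le> (\<integral>w. trunc_cube u (Y w) \<partial>N)"
proof -
  let ?g = "\<lambda>\<phi> u t. (2 * cos (t * u) * \<phi> t - 2 + t\<^sup>2 * (m + u\<^sup>2)) / t ^ 4"
  note gX = cos_law_cube_formula(1)[OF X] and gY = cos_law_cube_formula(1)[OF Y]
  have diff: "?g \<psi> u t - ?g \<phi> u t = 2 * ((\<psi> t - \<phi> t) / t ^ 4 * cos (t * u))" for u t
    unfolding diff_divide_distrib[symmetric] by (simp add: algebra_simps)
  have "integrable lborel (\<lambda>t. (?g \<psi> 0 t - ?g \<phi> 0 t) / 2)"
    by (intro integrable_divide_zero Bochner_Integration.integrable_diff gX gY)
  then have "integrable lborel (\<lambda>t. (2 * ((\<psi> t - \<phi> t) / t ^ 4 * cos (t * 0))) / 2)"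
    by (simp only: diff)
  then have "integrable lborel (\<lambda>t. (\<psi> t - \<phi> t) / t ^ 4)"
    by (simp only: mult_zero_right cos_zero mult_1_right nonzero_mult_div_cancel_left zero_neq_numeral not_False_eq_True)
  from pos_type_undamped_transform_nonneg[OF pos this, of u]
  have "0 \<le> 2 * (\<integral>t. (\<psi> t - \<phi> t) / t ^ 4 * cos (t * u) \<partial>lborel)"
    by (rule mult_nonneg_nonneg[OF zero_le_numeral])
  also have "\<dots> = (\<integral>t. 2 * ((\<psi> t - \<phi> t) / t ^ 4 * cos (t * u)) \<partial>lborel)"
    by (rule integral_mult_right_zero[symmetric])
  also have "\<dots> = (\<integral>t. ?g \<psi> u t \<partial>lborel) - (\<integral>t. ?g \<phi> u t \<partial>lborel)"
    unfolding diff[symmetric] by (rule Bochner_Integration.integral_diff[OF gY gX])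
  finally have "2 * cube_const * (\<integral>w. trunc_cube u (X w) \<partial>M) \<le> 2 * cube_const * (\<integral>w. trunc_cube u (Y w) \<partial>N)"
    unfolding cos_law_trunc_cube(2)[OF X u] cos_law_trunc_cube(2)[OF Y u] by simp
  then show ?thesis using cube_const_pos by simp
qed

section \<open>From truncated cubes to powers\<close>

text \<open>
  For \<open>p > 3\<close> the Beta integral \<open>Beta 4 (p - 3)\<close>; only its positivity and finiteness are of interest.
\<close>

definition power_mix_const :: "real \<Rightarrow> ennreal" where
  "power_mix_const p = (\<integral>\<^sup>+u. ennreal (trunc_cube u 1 * u powr (p - 4)) * indicator {0..} u \<partial>lborel)"

text \<open>
  The substitution \<open>u = \<bar>x\<bar> * v\<close> in the integral on the left scales out the power of \<open>\<bar>x\<bar>\<close>.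
\<close>

lemma powr_eq_trunc_cube_mixture:
  assumes "p > 3"
  shows "(\<integral>\<^sup>+u. ennreal (trunc_cube u x * u powr (p - 4)) * indicator {0..} u \<partial>lborel)
    = power_mix_const p * ennreal (\<bar>x\<bar> powr p)"
proof (cases "x = 0")
  case True
  have "(\<integral>\<^sup>+u. ennreal (trunc_cube u x * u powr (p - 4)) * indicator {0..} u \<partial>lborel) = (\<integral>\<^sup>+u. 0 \<partial>(lborel :: real measure))"
    by (intro nn_integral_cong) (simp add: True trunc_cube_def indicator_def max_def)
  then show ?thesis using True by simp
next
  case False
  define y where "y = \<bar>x\<bar>"
  have y: "y > 0" using False by (simp add: y_def)
  have m: "(\<lambda>u. trunc_cube u z) \<in> borel_measurable borel" for z
    unfolding trunc_cube_def by measurable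
  have "(\<integral>\<^sup>+u. ennreal (trunc_cube u x * u powr (p - 4)) * indicator {0..} u \<partial>lborel)
     = ennreal \<bar>y\<bar> * (\<integral>\<^sup>+v. ennreal (trunc_cube (0 + y * v) x * (0 + y * v) powr (p - 4)) * indicator {0..} (0 + y * v) \<partial>lborel)"
    using y m by (intro nn_integral_real_affine) auto
  also have "(\<lambda>v. ennreal (trunc_cube (0 + y * v) x * (0 + y * v) powr (p - 4)) * indicator {0..} (0 + y * v))
     = (\<lambda>v. ennreal (y powr (p - 1)) * (ennreal (trunc_cube v 1 * v powr (p - 4)) * indicator {0..} v))"
  proof
    fix v
    show "ennreal (trunc_cube (0 + y * v) x * (0 + y * v) powr (p - 4)) * indicator {0..} (0 + y * v)
      = ennreal (y powr (p - 1)) * (ennreal (trunc_cube v 1 * v powr (p - 4)) * indicator {0..} v)"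
    proof (cases "v \<ge> 0")
      case True
      have "max 0 (y - y * v) = y * max 0 (1 - v)"
        using y by (simp add: max_def right_diff_distrib mult_le_cancel_left)
      then have "trunc_cube (y * v) x = y ^ 3 * trunc_cube v 1"
        by (simp add: trunc_cube_def y_def[symmetric] power_mult_distrib)
      moreover have "y ^ 3 * y powr (p - 4) = y powr (p - 1)"
        using y powr_add[of y 3 "p - 4"] by (simp add: powr_numeral)
      ultimately have "trunc_cube (y * v) x * (y * v) powr (p - 4)
          = y powr (p - 1) * (trunc_cube v 1 * v powr (p - 4))"
        using True y by (simp add: powr_mult algebra_simps)
      then show ?thesis using True y trunc_cube_nonneg by (simp add: ennreal_mult)
    next
      case False
      then show ?thesis using y by (simp add: mult_less_0_iff not_le zero_le_mult_iff indicator_def)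
    qed
  qed
  also have "(\<integral>\<^sup>+v. ennreal (y powr (p - 1)) * (ennreal (trunc_cube v 1 * v powr (p - 4)) * indicator {0..} v) \<partial>lborel)
     = ennreal (y powr (p - 1)) * power_mix_const p"
    unfolding power_mix_const_def using m by (intro nn_integral_cmult) auto
  also have "ennreal \<bar>y\<bar> * (ennreal (y powr (p - 1)) * power_mix_const p) = power_mix_const p * ennreal (y powr p)"
  proof -
    have "ennreal \<bar>y\<bar> * ennreal (y powr (p - 1)) = ennreal (y powr p)"
      using y powr_add[of y 1 "p - 1"] by (simp add: ennreal_mult[symmetric])
    then show ?thesis by (metis mult.assoc mult.commute)
  qed
  finally show ?thesis by (simp add: y_def)
qed

lemma power_mix_const_finite_nonzero:
  assumes "p > 3"
  shows "power_mix_const p \<noteq> 0" "power_mix_const p \<noteq> top"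
proof -
  have [measurable]: "(\<lambda>u. trunc_cube u z) \<in> borel_measurable borel" for z
    unfolding trunc_cube_def by measurable
  show "power_mix_const p \<noteq> 0"
  proof
    assume "power_mix_const p = 0"
    then have "AE u in lborel. ennreal (trunc_cube u 1 * u powr (p - 4)) * indicator {0..} u = 0"
      unfolding power_mix_const_def by (subst (asm) nn_integral_0_iff_AE) auto
    then have "AE u in lborel. u \<notin> {0<..<1::real}"
    proof eventually_elim
      case (elim u)
      show ?case
      proof
        assume "u \<in> {0<..<1}"
        then have "trunc_cube u 1 * u powr (p - 4) > 0" by (simp add: trunc_cube_def)
        with elim \<open>u \<in> {0<..<1}\<close> show False by (simp add: indicator_def)
      qed
    qed
    then have "emeasure lborel {0<..<1::real} = 0"
      by (subst (asm) AE_iff_measurable[of "{0<..<1}"]) auto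
    then show False by simp
  qed
  have "((\<lambda>u. if u \<in> {0..1} then u powr (p - 4) else 0) has_integral 1 powr (p - 4 + 1) / (p - 4 + 1)) UNIV"
    using has_integral_powr_from_0[of "p - 4" 1] assms by (subst has_integral_restrict_UNIV) simp
  then have "(\<integral>\<^sup>+u. ennreal (if u \<in> {0..1} then u powr (p - 4) else 0) \<partial>lborel) = ennreal (1 powr (p - 4 + 1) / (p - 4 + 1))"
    by (intro nn_integral_has_integral_lborel) auto
  moreover have "power_mix_const p \<le> (\<integral>\<^sup>+u. ennreal (if u \<in> {0..1} then u powr (p - 4) else 0) \<partial>lborel)"
    unfolding power_mix_const_def
  proof (rule nn_integral_mono)
    fix u :: real
    show "ennreal (trunc_cube u 1 * u powr (p - 4)) * indicator {0..} u
      \<le> ennreal (if u \<in> {0..1} then u powr (p - 4) else 0)"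
    proof (cases "u \<in> {0..1}")
      case True
      then have "trunc_cube u 1 \<le> 1" by (auto simp: trunc_cube_def power_le_one)
      then have "trunc_cube u 1 * u powr (p - 4) \<le> 1 * u powr (p - 4)" by (intro mult_right_mono) auto
      then show ?thesis using True by (simp add: ennreal_leI)
    qed (auto simp: trunc_cube_def indicator_def)
  qed
  ultimately show "power_mix_const p \<noteq> top" by (auto simp: top_unique)
qed

lemma nn_powr_moment_eq_mixture:
  assumes law: "cos_law M X m \<phi>" and p: "p > 3"
  shows "power_mix_const p * (\<integral>\<^sup>+w. ennreal (\<bar>X w\<bar> powr p) \<partial>M)
    = (\<integral>\<^sup>+u. ennreal (u powr (p - 4)) * indicator {0..} u * ennreal (\<integral>w. trunc_cube u (X w) \<partial>M) \<partial>lborel)"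
proof -
  interpret prob_space M using law by (simp add: cos_law_def)
  interpret pair_sigma_finite M lborel ..
  have [measurable]: "X \<in> borel_measurable M" using law by (simp add: cos_law_def)
  have [measurable]: "(\<lambda>p. trunc_cube (snd p) (X (fst p))) \<in> borel_measurable (M \<Otimes>\<^sub>M borel)"
    "(\<lambda>w. trunc_cube u (X w)) \<in> borel_measurable M" for u
    unfolding trunc_cube_def by measurable
  let ?f = "\<lambda>w u. ennreal (trunc_cube u (X w) * u powr (p - 4)) * indicator {0..} u"
  have "power_mix_const p * (\<integral>\<^sup>+w. ennreal (\<bar>X w\<bar> powr p) \<partial>M) = (\<integral>\<^sup>+w. (\<integral>\<^sup>+u. ?f w u \<partial>lborel) \<partial>M)"
    unfolding powr_eq_trunc_cube_mixture[OF p] by (rule nn_integral_cmult[symmetric]) simp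
  also have "\<dots> = (\<integral>\<^sup>+u. (\<integral>\<^sup>+w. ?f w u \<partial>M) \<partial>lborel)"
  proof (rule Fubini'[symmetric])
    show "(\<lambda>(w, u). ?f w u) \<in> borel_measurable (M \<Otimes>\<^sub>M lborel)"
      by (simp add: case_prod_beta')
  qed
  also have "\<dots> = (\<integral>\<^sup>+u. ennreal (u powr (p - 4)) * indicator {0..} u * ennreal (\<integral>w. trunc_cube u (X w) \<partial>M) \<partial>lborel)"
  proof (rule nn_integral_cong)
    fix u :: real
    show "(\<integral>\<^sup>+w. ?f w u \<partial>M) = ennreal (u powr (p - 4)) * indicator {0..} u * ennreal (\<integral>w. trunc_cube u (X w) \<partial>M)"
    proof (cases "u \<ge> 0")
      case True
      have "(\<integral>\<^sup>+w. ?f w u \<partial>M) = (\<integral>\<^sup>+w. ennreal (u powr (p - 4)) * ennreal (trunc_cube u (X w)) \<partial>M)"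
        using True trunc_cube_nonneg by (intro nn_integral_cong) (simp add: ennreal_mult mult.commute)
      also have "\<dots> = ennreal (u powr (p - 4)) * (\<integral>\<^sup>+w. ennreal (trunc_cube u (X w)) \<partial>M)"
        by (rule nn_integral_cmult) simp
      also have "(\<integral>\<^sup>+w. ennreal (trunc_cube u (X w)) \<partial>M) = ennreal (\<integral>w. trunc_cube u (X w) \<partial>M)"
        by (rule nn_integral_eq_integral[OF cos_law_trunc_cube(1)[OF law True]]) (simp add: trunc_cube_nonneg)
      finally show ?thesis using True by simp
    qed simp
  qed
  finally show ?thesis .
qed

text \<open>
  For \<open>p > 3\<close> the moment is a positive mixture of expectations of truncated cubes; for \<open>p = 3\<close> it is
  one of them, at \<open>u = 0\<close>. Working with nonnegative integrals gives integrability of the smaller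
  side as well.
\<close>

lemma abs_powr_moment_mono:
  assumes X: "cos_law M X m \<phi>" and Y: "cos_law N Y m \<psi>"
    and pos: "pos_type C (\<lambda>t. (\<psi> t - \<phi> t) / t ^ 4)" and p: "p \<ge> 3"
    and int: "integrable N (\<lambda>w. \<bar>Y w\<bar> powr p)"
  shows "integrable M (\<lambda>w. \<bar>X w\<bar> powr p)"
    and "(\<integral>w. \<bar>X w\<bar> powr p \<partial>M) \<le> (\<integral>w. \<bar>Y w\<bar> powr p \<partial>N)"
proof -
  have [measurable]: "X \<in> borel_measurable M" using X by (simp add: cos_law_def)
  note mono = trunc_cube_mono[OF X Y pos]
  have le: "(\<integral>\<^sup>+w. ennreal (\<bar>X w\<bar> powr p) \<partial>M) \<le> (\<integral>\<^sup>+w. ennreal (\<bar>Y w\<bar> powr p) \<partial>N)"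
  proof (cases "p = 3")
    case True
    have cube: "\<bar>x\<bar> powr p = trunc_cube 0 x" for x
      using True by (simp add: trunc_cube_def)
    have "(\<integral>\<^sup>+w. ennreal (\<bar>X w\<bar> powr p) \<partial>M) = ennreal (\<integral>w. trunc_cube 0 (X w) \<partial>M)"
      unfolding cube by (rule nn_integral_eq_integral[OF cos_law_trunc_cube(1)[OF X]]) (simp_all add: trunc_cube_nonneg)
    also have "\<dots> \<le> ennreal (\<integral>w. trunc_cube 0 (Y w) \<partial>N)"
      by (intro ennreal_leI mono) simp
    also have "\<dots> = (\<integral>\<^sup>+w. ennreal (\<bar>Y w\<bar> powr p) \<partial>N)"
      unfolding cube by (rule nn_integral_eq_integral[OF cos_law_trunc_cube(1)[OF Y], symmetric]) (simp_all add: trunc_cube_nonneg)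
    finally show ?thesis .
  next
    case False
    then have p': "p > 3" using p by simp
    have "power_mix_const p * (\<integral>\<^sup>+w. ennreal (\<bar>X w\<bar> powr p) \<partial>M)
        \<le> power_mix_const p * (\<integral>\<^sup>+w. ennreal (\<bar>Y w\<bar> powr p) \<partial>N)"
      unfolding nn_powr_moment_eq_mixture[OF X p'] nn_powr_moment_eq_mixture[OF Y p']
    proof (rule nn_integral_mono)
      fix u :: real
      show "ennreal (u powr (p - 4)) * indicator {0..} u * ennreal (\<integral>w. trunc_cube u (X w) \<partial>M)
        \<le> ennreal (u powr (p - 4)) * indicator {0..} u * ennreal (\<integral>w. trunc_cube u (Y w) \<partial>N)"
        using mono[of u] by (cases "u \<ge> 0") (auto intro!: mult_left_mono ennreal_leI)
    qed
    then show ?thesis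
      by (simp add: ennreal_mult_le_mult_iff power_mix_const_finite_nonzero[OF p'])
  qed
  have Y_eq: "(\<integral>\<^sup>+w. ennreal (\<bar>Y w\<bar> powr p) \<partial>N) = ennreal (\<integral>w. \<bar>Y w\<bar> powr p \<partial>N)"
    by (rule nn_integral_eq_integral[OF int]) simp
  show intX: "integrable M (\<lambda>w. \<bar>X w\<bar> powr p)"
    using le by (intro integrableI_bounded) (auto simp: Y_eq intro: le_less_trans)
  have "(\<integral>\<^sup>+w. ennreal (\<bar>X w\<bar> powr p) \<partial>M) = ennreal (\<integral>w. \<bar>X w\<bar> powr p \<partial>M)"
    by (rule nn_integral_eq_integral[OF intX]) simp
  then show "(\<integral>w. \<bar>X w\<bar> powr p \<partial>M) \<le> (\<integral>w. \<bar>Y w\<bar> powr p \<partial>N)"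
    using le by (simp add: Y_eq)
qed

section \<open>Laws with the required transforms\<close>

lemma cos_law_of_density:
  assumes "prob_space M" and Z: "distributed M lborel Z f" and f: "\<And>x. 0 \<le> f x"
    and cube: "integrable lborel (\<lambda>x. f x * \<bar>x\<bar> ^ 3)"
    and square: "(\<integral>x. f x * x\<^sup>2 \<partial>lborel) = v"
    and transform: "\<And>t. (\<integral>x. f x * cos (t * x) \<partial>lborel) = \<psi> t"
  shows "cos_law M (\<lambda>w. c * Z w) (c\<^sup>2 * v) (\<lambda>t. \<psi> (c * t))"
proof -
  have [measurable]: "Z \<in> borel_measurable M"
    using distributed_measurable[OF Z] by simp
  have "integrable M (\<lambda>w. \<bar>Z w\<bar> ^ 3)"
    using distributed_integrable[OF Z, of "\<lambda>x. \<bar>x\<bar> ^ 3"] cube f by simp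
  moreover have "(\<integral>w. (Z w)\<^sup>2 \<partial>M) = v"
    using distributed_integral[OF Z, of "\<lambda>x. x\<^sup>2"] square f by simp
  moreover have "(\<integral>w. cos (t * (c * Z w)) \<partial>M) = \<psi> (c * t)" for t
    using distributed_integral[OF Z, of "\<lambda>x. cos ((c * t) * x)"] transform[of "c * t"] f
    by (simp add: mult_ac)
  ultimately show ?thesis
    using assms(1) by (simp add: cos_law_def abs_mult power_mult_distrib)
qed

lemma integrable_std_normal_abs_powr:
  assumes "p \<ge> 0"
  shows "integrable lborel (\<lambda>x. std_normal_density x * \<bar>x\<bar> powr p)"
proof (rule Bochner_Integration.integrable_bound)
  define n where "n = nat \<lceil>p\<rceil>"
  show "integrable lborel (\<lambda>x. std_normal_density x + std_normal_density x * \<bar>x\<bar> ^ n)"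
    by (intro Bochner_Integration.integrable_add integrable_std_normal_moment_abs integrable_normal_density) simp
  have "\<bar>x\<bar> powr p \<le> 1 + \<bar>x\<bar> ^ n" for x :: real
  proof (cases "\<bar>x\<bar> \<le> 1")
    case True
    then have "\<bar>x\<bar> powr p \<le> 1" using assms by (intro powr_le1) auto
    then show ?thesis by (simp add: add_increasing2)
  next
    case False
    then have "\<bar>x\<bar> powr p \<le> \<bar>x\<bar> powr real n"
      using assms by (intro powr_mono) (auto simp: n_def real_nat_ceiling_ge)
    then show ?thesis using False by (simp add: powr_realpow)
  qed
  then have "std_normal_density x * \<bar>x\<bar> powr p \<le> std_normal_density x * (1 + \<bar>x\<bar> ^ n)" for x
    by (intro mult_left_mono) auto
  then show "AE x in lborel. norm (std_normal_density x * \<bar>x\<bar> powr p)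
     \<le> norm (std_normal_density x + std_normal_density x * \<bar>x\<bar> ^ n)"
    by (intro AE_I2) (simp add: abs_mult distrib_left power_add mult.assoc)
qed measurable

text \<open>
  The difference quotients \<open>2 * (1 - cos (h * X w)) / h\<^sup>2\<close> are dominated by \<open>(X w)\<^sup>2\<close>, so the second
  moment can be read off from any function that agrees with \<open>\<phi>\<close> to fourth order at the origin.
\<close>

lemma second_moment_of_cos_transform:
  fixes X :: "'a \<Rightarrow> real" and \<phi> :: "real \<Rightarrow> real"
  assumes M: "prob_space M" and X[measurable]: "X \<in> borel_measurable M"
    and sq: "integrable M (\<lambda>w. (X w)\<^sup>2)" and \<phi>: "\<And>t. (\<integral>w. cos (t * X w) \<partial>M) = \<phi> t"
    and near: "\<And>t. \<bar>exp (- s * t\<^sup>2) - \<phi> t\<bar> \<le> C * t ^ 4" and s: "s > 0"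
  shows "(\<integral>w. (X w)\<^sup>2 \<partial>M) = 2 * s"
proof (rule LIMSEQ_unique)
  interpret prob_space M by (rule M)
  define h where "h n = inverse (real (Suc n))" for n
  have h: "h n > 0" for n by (simp add: h_def)
  have h0: "h \<longlonglongrightarrow> 0" unfolding h_def[abs_def] by (rule LIMSEQ_inverse_real_of_nat)
  have icos: "integrable M (\<lambda>w. cos (t * X w))" for t
    by (rule integrable_const_bound[where B = 1]) auto
  show "(\<lambda>n. \<integral>w. 2 * (1 - cos (h n * X w)) / (h n)\<^sup>2 \<partial>M) \<longlonglongrightarrow> (\<integral>w. (X w)\<^sup>2 \<partial>M)"
  proof (rule integral_dominated_convergence[where w = "\<lambda>w. (X w)\<^sup>2"])
    show "AE w in M. norm (2 * (1 - cos (h n * X w)) / (h n)\<^sup>2) \<le> (X w)\<^sup>2" for n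
    proof (rule AE_I2)
      fix w
      have "2 * (1 - cos (h n * X w)) \<le> (h n * X w)\<^sup>2"
        using cos_quadratic_lower[of "h n * X w"] by simp
      then show "norm (2 * (1 - cos (h n * X w)) / (h n)\<^sup>2) \<le> (X w)\<^sup>2"
        using h[of n] by (simp add: power_mult_distrib divide_le_eq mult.commute)
    qed
    have "(\<lambda>n. 2 * (1 - cos (h n * x)) / (h n)\<^sup>2) \<longlonglongrightarrow> x\<^sup>2" for x
      unfolding h_def power2_eq_square by real_asymp
    then show "AE w in M. (\<lambda>n. 2 * (1 - cos (h n * X w)) / (h n)\<^sup>2) \<longlonglongrightarrow> (X w)\<^sup>2" by simp
  qed (use sq in auto)
  have eq: "(\<integral>w. 2 * (1 - cos (h n * X w)) / (h n)\<^sup>2 \<partial>M) = 2 * (1 - \<phi> (h n)) / (h n)\<^sup>2" for n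
    using icos[of "h n"] by (simp add: \<phi> prob_space)
  have diff: "(\<lambda>n. 2 * (1 - \<phi> (h n)) / (h n)\<^sup>2 - 2 * (1 - exp (- s * (h n)\<^sup>2)) / (h n)\<^sup>2) \<longlonglongrightarrow> 0"
  proof (rule Lim_null_comparison)
    show "\<forall>\<^sub>F n in sequentially. norm (2 * (1 - \<phi> (h n)) / (h n)\<^sup>2 - 2 * (1 - exp (- s * (h n)\<^sup>2)) / (h n)\<^sup>2) \<le> 2 * C * (h n)\<^sup>2"
    proof (rule always_eventually, rule allI)
      fix n
      have "2 * (1 - \<phi> (h n)) / (h n)\<^sup>2 - 2 * (1 - exp (- s * (h n)\<^sup>2)) / (h n)\<^sup>2
         = 2 * (exp (- s * (h n)\<^sup>2) - \<phi> (h n)) / (h n)\<^sup>2"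
        by (simp add: diff_divide_distrib right_diff_distrib)
      also have "norm \<dots> = 2 * \<bar>exp (- s * (h n)\<^sup>2) - \<phi> (h n)\<bar> / (h n)\<^sup>2"
        unfolding real_norm_def abs_divide abs_mult by simp
      also have "\<dots> \<le> 2 * (C * h n ^ 4) / (h n)\<^sup>2"
        by (intro divide_right_mono mult_left_mono near) auto
      also have "\<dots> = 2 * C * (h n)\<^sup>2"
        using h[of n] by (simp add: eval_nat_numeral)
      finally show "norm (2 * (1 - \<phi> (h n)) / (h n)\<^sup>2 - 2 * (1 - exp (- s * (h n)\<^sup>2)) / (h n)\<^sup>2) \<le> 2 * C * (h n)\<^sup>2" .
    qed
    show "(\<lambda>n. 2 * C * (h n)\<^sup>2) \<longlonglongrightarrow> 0"
      using tendsto_mult[OF tendsto_const tendsto_power[OF h0], of "2 * C" 2] by simp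
  qed
  have "(\<lambda>n. 2 * (1 - exp (- s * (h n)\<^sup>2)) / (h n)\<^sup>2) \<longlonglongrightarrow> 2 * s"
    unfolding h_def using s by real_asymp
  from tendsto_add[OF diff this]
  show "(\<lambda>n. \<integral>w. 2 * (1 - cos (h n * X w)) / (h n)\<^sup>2 \<partial>M) \<longlonglongrightarrow> 2 * s"
    unfolding eq by (simp only: diff_add_cancel add_0_left)
qed

lemma type_L_integrable_exp:
  assumes "type_L M X"
  shows "integrable M (\<lambda>w. exp (r * X w))"
proof -
  have "complex_integrable M (\<lambda>w. exp (complex_of_real r * complex_of_real (X w)))"
    using assms by (simp add: type_L_def)
  from integrable_norm[OF this] show ?thesis by simp
qed

text \<open>
  Exponential moments in both directions dominate every power.
\<close>

lemma type_L_integrable_cube: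
  assumes L: "type_L M X" and [measurable]: "X \<in> borel_measurable M"
  shows "integrable M (\<lambda>w. \<bar>X w\<bar> ^ 3)"
proof (rule Bochner_Integration.integrable_bound)
  show "integrable M (\<lambda>w. 27 * (exp (1 * X w) + exp ((-1) * X w)))"
    using type_L_integrable_exp[OF L] by (intro integrable_mult_right Bochner_Integration.integrable_add) 
  have "\<bar>x\<bar> ^ 3 \<le> 27 * (exp x + exp (- x))" for x :: real
  proof -
    \<comment> \<open>The constant 27 comes from cubing this.\<close>
    have "\<bar>x\<bar> / 3 \<le> exp (\<bar>x\<bar> / 3)" using exp_ge_add_one_self[of "\<bar>x\<bar> / 3"] by linarith
    then have "(\<bar>x\<bar> / 3) ^ 3 \<le> exp (\<bar>x\<bar> / 3) ^ 3" by (intro power_mono) auto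
    also have "\<dots> = exp \<bar>x\<bar>" using exp_divide_power_eq[of 3 "\<bar>x\<bar>"] by simp
    also have "\<dots> \<le> exp x + exp (- x)" by (cases "x \<ge> 0") auto
    finally show ?thesis by (simp add: power_divide)
  qed
  then show "AE w in M. norm (\<bar>X w\<bar> ^ 3) \<le> norm (27 * (exp (1 * X w) + exp ((-1) * X w)))"
    by (intro AE_I2) (simp add: abs_of_nonneg)
qed simp

text \<open>
  A real characteristic function is that of \<open>- X\<close> as well, so by Levy's uniqueness theorem the law
  is symmetric.
\<close>

lemma expectation_zero_of_real_char:
  assumes M: "prob_space M" and X[measurable]: "X \<in> borel_measurable M"
    and real_char: "\<And>t. char (distr M borel X) t = complex_of_real (\<phi> t)"
  shows "(\<integral>w. X w \<partial>M) = 0"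
proof -
  interpret prob_space M by (rule M)
  have rd: "real_distribution (distr M borel X)" "real_distribution (distr M borel (\<lambda>w. - X w))"
    by (rule real_distribution_distr, simp)+
  have "char (distr M borel (\<lambda>w. - X w)) t = cnj (char (distr M borel X) t)" for t
  proof -
    have "char (distr M borel (\<lambda>w. - X w)) t = (CLINT w|M. iexp (t * - X w))"
      by (simp add: char_def integral_distr)
    also have "\<dots> = (CLINT w|M. cnj (iexp (t * X w)))"
      by (simp only: exp_cnj) simp
    also have "\<dots> = cnj (CLINT w|M. iexp (t * X w))"
      by (rule Bochner_Integration.integral_cnj)
    finally show ?thesis by (simp add: char_def integral_distr)
  qed
  then have "char (distr M borel (\<lambda>w. - X w)) = char (distr M borel X)"
    by (simp add: real_char fun_eq_iff)
  then have "distr M borel (\<lambda>w. - X w) = distr M borel X"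
    by (rule Levy_uniqueness[OF rd(2,1)])
  then have "(\<integral>x. x \<partial>distr M borel (\<lambda>w. - X w)) = (\<integral>x. x \<partial>distr M borel X)" by simp
  then show ?thesis by (simp add: integral_distr)
qed

section \<open>The moment comparison\<close>

theorem theorem5:
  fixes M :: "'a measure" and M0 :: "'b measure" and M1 :: "'c measure"
    and X :: "'a \<Rightarrow> real" and Z0 :: "'b \<Rightarrow> real" and Z1 :: "'c \<Rightarrow> real"
    and a p \<sigma> :: real and b :: "nat \<Rightarrow> real"
  assumes "prob_space M" and "prob_space.random_variable M borel X"
    and "type_L M X"
    and "a > 0" and "\<And>j. b j \<ge> 0" and "summable b" and "(\<Sum>j. b j) \<le> a"
    and "\<And>t. char (distr M borel X) t =
           complex_of_real (exp (- a * t\<^sup>2 / 2) * (\<Prod>j. 1 - b j * t\<^sup>2))"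
    and "\<sigma> = sqrt (prob_space.variance M X)"
    and "prob_space M0" and "distributed M0 lborel Z0 std_normal_density"
    and "prob_space M1" and "distributed M1 lborel Z1 Z1_density"
    and "p \<ge> 3"
  shows "prob_space.expectation M1 (\<lambda>w. \<bar>\<sigma> * Z1 w / sqrt 3\<bar> powr p)
           \<le> prob_space.expectation M (\<lambda>w. \<bar>X w\<bar> powr p)
       \<and> prob_space.expectation M (\<lambda>w. \<bar>X w\<bar> powr p)
           \<le> prob_space.expectation M0 (\<lambda>w. \<bar>\<sigma> * Z0 w\<bar> powr p)"
proof -
  interpret M: prob_space M by fact
  note X[measurable] = assms(2)
  define B where "B = (\<Sum>j. b j)"
  \<comment> \<open>\<open>m\<close> is minus the second derivative of the characteristic function at \<open>0\<close>.\<close>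
  define m where "m = a + 2 * B"
  define \<phi> where "\<phi> t = exp (- a * t\<^sup>2 / 2) * (\<Prod>j. 1 - b j * t\<^sup>2)" for t
  have B: "B \<ge> 0" unfolding B_def using assms(5,6) by (rule suminf_nonneg[rotated])
  have char_X: "char (distr M borel X) t = complex_of_real (\<phi> t)" for t
    unfolding \<phi>_def by (rule assms(8))
  have cos_X: "(\<integral>w. cos (t * X w) \<partial>M) = \<phi> t" for t
  proof -
    have "\<phi> t = Re (CLINT w|M. iexp (t * X w))"
      using char_X[of t] by (simp add: char_def integral_distr)
    also have "\<dots> = (\<integral>w. Re (iexp (t * X w)) \<partial>M)"
      by (rule integral_Re[symmetric, OF M.integrable_iexp]) simp_all
    finally show ?thesis by (simp add: Re_exp)
  qed
  \<comment> \<open>The two Fourier inequalities; \<open>s = m / 3\<close> in the second one.\<close>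
  have upper: "pos_type (a\<^sup>2 / 2) (\<lambda>t. (exp (- (m / 2) * t\<^sup>2) - \<phi> t) / t ^ 4)"
    using pos_type_gauss_minus_infinite_prod[OF assms(6,5,7) B_def]
    by (simp add: \<phi>_def m_def add_divide_distrib)
  have lower: "pos_type (2 * a\<^sup>2) (\<lambda>t. (\<phi> t - (1 - m / 3 * t\<^sup>2) * exp (- (m / 3 * t\<^sup>2) / 2)) / t ^ 4)"
    using pos_type_infinite_prod_minus_linear[OF assms(6,5,7) B_def, of "m / 3"]
    by (simp add: \<phi>_def m_def mult.commute)
  have cube: "integrable M (\<lambda>w. \<bar>X w\<bar> ^ 3)"
    by (rule type_L_integrable_cube[OF assms(3) X])
  have square: "integrable M (\<lambda>w. (X w)\<^sup>2)"
    using cos_law_integrable_square[of M X "\<integral>w. (X w)\<^sup>2 \<partial>M" \<phi>] cube cos_X M.prob_space_axioms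
    by (simp add: cos_law_def)
  have "(\<integral>w. (X w)\<^sup>2 \<partial>M) = 2 * (m / 2)"
  proof (rule second_moment_of_cos_transform[OF M.prob_space_axioms X square cos_X])
    show "\<bar>exp (- (m / 2) * t\<^sup>2) - \<phi> t\<bar> \<le> a\<^sup>2 / 2 * t ^ 4" for t
    proof (cases "t = 0")
      case False
      have "t ^ 4 > 0" using False by simp
      then show ?thesis
        using pos_type_abs_le[OF upper, of t] by (simp add: abs_divide divide_le_eq)
    qed (simp add: \<phi>_def)
    show "m / 2 > 0" using assms(4) B by (simp add: m_def)
  qed
  then have second_moment: "(\<integral>w. (X w)\<^sup>2 \<partial>M) = m" by simp
  have "\<sigma> = sqrt m"
    using assms(9) expectation_zero_of_real_char[OF M.prob_space_axioms X char_X] second_moment by simp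
  then have \<sigma>: "\<sigma>\<^sup>2 = m" using assms(4) B by (simp add: m_def)
  have law_X: "cos_law M X m \<phi>"
    using M.prob_space_axioms cube second_moment cos_X by (simp add: cos_law_def)
  have "cos_law M0 (\<lambda>w. \<sigma> * Z0 w) (\<sigma>\<^sup>2 * 1) (\<lambda>t. exp (- ((\<sigma> * t)\<^sup>2) / 2))"
  proof (rule cos_law_of_density[OF assms(10,11)])
    show "(\<integral>x. std_normal_density x * x\<^sup>2 \<partial>lborel) = 1"
      using integral_std_normal_moment_even[of 1] by simp
  qed (simp_all add: integrable_std_normal_moment_abs std_normal_cos_transform)
  then have law_Z0: "cos_law M0 (\<lambda>w. \<sigma> * Z0 w) m (\<lambda>t. exp (- (m / 2) * t\<^sup>2))"
    by (simp add: power_mult_distrib \<sigma>)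
  have "cos_law M1 (\<lambda>w. \<sigma> / sqrt 3 * Z1 w) ((\<sigma> / sqrt 3)\<^sup>2 * 3)
      (\<lambda>t. (1 - (\<sigma> / sqrt 3 * t)\<^sup>2) * exp (- ((\<sigma> / sqrt 3 * t)\<^sup>2) / 2))"
  proof (rule cos_law_of_density[OF assms(12,13) Z1_density_nonneg])
    have "Z1_density x * \<bar>x\<bar> ^ 3 = std_normal_density x * \<bar>x\<bar> ^ 5" for x
      by (simp add: Z1_density_eq eval_nat_numeral)
    then show "integrable lborel (\<lambda>x. Z1_density x * \<bar>x\<bar> ^ 3)"
      by (simp add: integrable_std_normal_moment_abs)
    have "Z1_density x * x\<^sup>2 = std_normal_density x * x ^ (2 * 2)" for x
      by (simp add: Z1_density_eq eval_nat_numeral)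
    then show "(\<integral>x. Z1_density x * x\<^sup>2 \<partial>lborel) = 3"
      using integral_std_normal_moment_even[of 2] by (simp add: fact_numeral)
  qed (rule Z1_cos_transform)
  then have law_Z1: "cos_law M1 (\<lambda>w. \<sigma> / sqrt 3 * Z1 w) m
      (\<lambda>t. (1 - m / 3 * t\<^sup>2) * exp (- (m / 3 * t\<^sup>2) / 2))"
    by (simp add: power_mult_distrib power_divide \<sigma>)
  have "integrable M0 (\<lambda>w. \<bar>Z0 w\<bar> powr p)"
    using distributed_integrable[OF assms(11), of "\<lambda>x. \<bar>x\<bar> powr p"]
      integrable_std_normal_abs_powr[of p] assms(14) by simp
  then have int_Z0: "integrable M0 (\<lambda>w. \<bar>\<sigma> * Z0 w\<bar> powr p)"
    by (simp add: abs_mult powr_mult)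
  note upper_bound = abs_powr_moment_mono[OF law_X law_Z0 upper assms(14) int_Z0]
  have lower_bound: "(\<integral>w. \<bar>\<sigma> / sqrt 3 * Z1 w\<bar> powr p \<partial>M1) \<le> (\<integral>w. \<bar>X w\<bar> powr p \<partial>M)"
    by (rule abs_powr_moment_mono(2)[OF law_Z1 law_X lower assms(14) upper_bound(1)])
  show ?thesis
    using upper_bound(2) lower_bound by simp
qed

end
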